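(* Let $r\in\{2,3,\dots,9\}$ and let $n_{\mathrm{cp}}\ge 0$ be an integer with $n_{\mathrm{cp}}<r-1$. Put $$k^{\mathrm{MAIM}}=\left\lceil \frac{r}{r-1-n_{\mathrm{cp}}}-2\right\rceil+\frac{1+(-1)^{\left\lceil \frac{r}{r-1-n_{\mathrm{cp}}}-2\right\rceil}}{2}.$$ Let $k$ be a positive integer with $k\ge k^{\mathrm{MAIM}}$ and let $i\in\{1,2,3,4,5\}$. Let the modified adaptive improved mapping functions $(g^{\mathrm{MAIM}i})_s(\omega)$ with this parameter $k$ (and any admissible values of the other parameters) be applied to the original weights $\omega_s^{\mathrm{JS}}$ of the $(2r-1)$th-order WENO-JS scheme. Then the resulting WENO-MAIM$i$ scheme achieves the optimal $(2r-1)$th order of accuracy in smooth regions at a point $x^*$ where the solution has a critical point of order $n_{\mathrm{cp}}$. That is, if $u$ is $C^\infty$ near $x^*$, $u^{(l)}(x^* )=0$ for $1\le l\le n_{\mathrm{cp}}$, $u^{(n_{\mathrm{cp}}+1)}(x^* )\neq 0$, and $x^*\in I_j$, then as $\Delta x\to0$ $$\frac{u^-_{j+1/2}-u^-_{j-1/2}}{\Delta x}=\frac{u(x_{j+1/2})-u(x_{j-1/2})}{\Delta x}+O(\Delta x^{2r-1}),$$ where $u^-_{j\pm1/2}$ are the WENO-MAIM$i$ reconstructions.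
   Context: Grid: uniform cells $I_j=[x_{j-1/2},x_{j+1/2}]$ of width $\Delta x$. The data are the exact cell averages $\bar u_j=\frac1{\Delta x}\int_{I_j}u\,dx$. Candidate reconstructions: for $s=0,\dots,r-1$ let $p_{j,s}$ be the unique polynomial of degree $\le r-1$ whose averages over the $r$ cells $I_{j+s-r+1},\dots,I_{j+s}$ equal the $\bar u$'s of those cells, and put $u^{s,-}_{j+1/2}=p_{j,s}(x_{j+1/2})$. Optimal weights: $d_s=\binom{r}{s}\binom{r-1}{s}/\binom{2r-1}{r}\in(0,1)$, which satisfy $\sum_s d_s=1$ and $\sum_s d_su^{s,-}_{j+1/2}=u(x_{j+1/2})+O(\Delta x^{2r-1})$ for smooth $u$. (For $r=3$: $d_0=0.1$, $d_1=0.6$, $d_2=0.3$.) Jiang–Shu smoothness indicators: $\beta_s=\sum_{l=1}^{r-1}\Delta x^{2l-1}\int_{I_j}\big(p_{j,s}^{(l)}(x)\big)^2dx$. WENO-JS weights: $\omega^{\mathrm{JS}}_s=\alpha^{\mathrm{JS}}_s/\sum_{l}\alpha^{\mathrm{JS}}_l$ with $\alpha_s^{\mathrm{JS}}=d_s/(\epsilon+\beta_s)^2$. Here $\epsilon>0$ is a small number whose only role is to prevent a zero denominator, so it is regarded as negligible: the constants implied by $O(\cdot)$ must not depend on $\epsilon$. They may depend on $u$, $x^*$, $r$ and the parameters of the mapping, but not on $\Delta x$. WENO-MAIM$i$: $\alpha_s^{\mathrm{MAIM}i}=(g^{\mathrm{MAIM}i})_s(\omega_s^{\mathrm{JS}})$,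 $\omega_s^{\mathrm{MAIM}i}=\alpha_s^{\mathrm{MAIM}i}/\sum_{l=0}^{r-1}\alpha_l^{\mathrm{MAIM}i}$, and $u^-_{j+1/2}=\sum_{s=0}^{r-1}\omega_s^{\mathrm{MAIM}i}u^{s,-}_{j+1/2}$. The value $u^-_{j-1/2}$ is obtained in the same way from the cell $I_{j-1}$. Mapping functions: for $k\in\mathbb N^+$, $A>0$, $$(g^{\mathrm{MAIM}i})_s(\omega)=d_s+\frac{f_s^{\mathrm{MAIM}}\,(\omega-d_s)^{k+1}}{f_s^{\mathrm{MAIM}}\,(\omega-d_s)^k+\omega^{f^{\mathrm{Ada}0}_{i,s}}(1-\omega)^{f^{\mathrm{Ada}1}_{i,s}}},$$ $$f_s^{\mathrm{MAIM}}=A\Big(\tfrac{1+(-1)^k}{2}+\tfrac{1+(-1)^{k+1}}{2}\,sg(\omega-d_s,\delta)\Big),$$ where $\delta>0$ is a small constant and $sg(x,\delta)=x/|x|$ if $|x|\ge\delta$, $sg(x,\delta)=\dfrac{x}{(\delta^2-x^2)^{k+3}+|x|}$ if $|x|<\delta$. Adaptive control functions: Type $i=1$: $f^{\mathrm{Ada}0}_{1,s}=\frac{d_s}{m_s\omega}$, $f^{\mathrm{Ada}1}_{1,s}=\frac{1-d_s}{m_s(1-\omega)}$, with a constant $m_s\in[\frac{\alpha_s}{k+1},M)$, where $M$ is a finite positive constant, $\alpha_s>\max\big(0,\max_{0<\omega<1}q_s(\omega)\big)$ and $q_s(\omega)=(\omega-d_s)\big(\frac{d_s}{\omega^2}(1-\ln\omega)+\frac{1-d_s}{(1-\omega)^2}(\ln(1-\omega)-1)\big)$.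 Type $i=2$: $f^{\mathrm{Ada}0}_{2,s}=f^{\mathrm{Ada}1}_{2,s}=1$ if $\mathrm{CFS}_s<\omega<1-\frac{1-d_s}{d_s}\mathrm{CFS}_s$ and $=Qk$ otherwise, with constants $Q\ge k^{-1}$ and $\mathrm{CFS}_s\in(0,d_s]$. Type $i=3$: $f^{\mathrm{Ada}0}_{3,s}=f^{\mathrm{Ada}1}_{3,s}=\max_{0\le l\le r-1}\beta_l\,/\min_{0\le l\le r-1}\beta_l$. Type $i=4$: $f^{\mathrm{Ada}0}_{4,s}=f^{\mathrm{Ada}1}_{4,s}=\max_{0\le l\le r-1}(\omega_l/d_l)\,/\min_{0\le l\le r-1}(\omega_l/d_l)$ with $\omega_l=\omega_l^{\mathrm{JS}}$. Type $i=5$: $f^{\mathrm{Ada}0}_{5,s}=f^{\mathrm{Ada}1}_{5,s}=C$, a constant $C\ge1$. *)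

theory Defs
  imports "HOL-Analysis.Analysis" "HOL-Computational_Algebra.Polynomial"
begin

(* "C-infinity near x": all iterated derivatives exist on an open neighbourhood of x. *)
definition smooth_near :: "(real \<Rightarrow> real) \<Rightarrow> real \<Rightarrow> bool" where
  "smooth_near u x \<longleftrightarrow>
     (\<exists>S. open S \<and> x \<in> S \<and> (\<forall>n. \<forall>y\<in>S. (deriv ^^ n) u field_differentiable (at y)))"

(* Uniform grid with spacing h and cell centres x0 + j h;
   edge x0 h j is the right end point x_{j+1/2} of the cell I_j. *)
definition edge :: "real \<Rightarrow> real \<Rightarrow> int \<Rightarrow> real" where
  "edge x0 h j = x0 + (of_int j + 1/2) * h"

definition cell :: "real \<Rightarrow> real \<Rightarrow> int \<Rightarrow> real set" where
  "cell x0 h j = {edge x0 h (j - 1) .. edge x0 h j}"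

definition cell_avg :: "(real \<Rightarrow> real) \<Rightarrow> real \<Rightarrow> real \<Rightarrow> int \<Rightarrow> real" where
  "cell_avg f x0 h j = (1 / h) * integral (cell x0 h j) f"

definition cand_poly ::
    "nat \<Rightarrow> (real \<Rightarrow> real) \<Rightarrow> real \<Rightarrow> real \<Rightarrow> int \<Rightarrow> nat \<Rightarrow> real poly" where
  "cand_poly r u x0 h j s =
     (THE p. degree p \<le> r - 1 \<and>
        (\<forall>i \<in> {j + int s - int r + 1 .. j + int s}.
            cell_avg (poly p) x0 h i = cell_avg u x0 h i))"

definition cand_value ::
    "nat \<Rightarrow> (real \<Rightarrow> real) \<Rightarrow> real \<Rightarrow> real \<Rightarrow> int \<Rightarrow> nat \<Rightarrow> real" where
  "cand_value r u x0 h j s = poly (cand_poly r u x0 h j s) (edge x0 h j)"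

definition opt_weight :: "nat \<Rightarrow> nat \<Rightarrow> real" where
  "opt_weight r s = real (r choose s) * real ((r - 1) choose s) / real ((2 * r - 1) choose r)"

definition smooth_ind ::
    "nat \<Rightarrow> (real \<Rightarrow> real) \<Rightarrow> real \<Rightarrow> real \<Rightarrow> int \<Rightarrow> nat \<Rightarrow> real" where
  "smooth_ind r u x0 h j s =
     (\<Sum>l = 1..r - 1. h ^ (2 * l - 1) *
        integral (cell x0 h j) (\<lambda>x. (poly ((pderiv ^^ l) (cand_poly r u x0 h j s)) x)\<^sup>2))"

definition js_alpha ::
    "nat \<Rightarrow> real \<Rightarrow> (real \<Rightarrow> real) \<Rightarrow> real \<Rightarrow> real \<Rightarrow> int \<Rightarrow> nat \<Rightarrow> real" where
  "js_alpha r eps u x0 h j s = opt_weight r s / (eps + smooth_ind r u x0 h j s)\<^sup>2"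

definition js_weight ::
    "nat \<Rightarrow> real \<Rightarrow> (real \<Rightarrow> real) \<Rightarrow> real \<Rightarrow> real \<Rightarrow> int \<Rightarrow> nat \<Rightarrow> real" where
  "js_weight r eps u x0 h j s =
     js_alpha r eps u x0 h j s / (\<Sum>l<r. js_alpha r eps u x0 h j l)"

definition sg :: "nat \<Rightarrow> real \<Rightarrow> real \<Rightarrow> real" where
  "sg k \<delta> x = (if \<bar>x\<bar> \<ge> \<delta> then x / \<bar>x\<bar> else x / ((\<delta>\<^sup>2 - x\<^sup>2) ^ (k + 3) + \<bar>x\<bar>))"

definition maim_f :: "nat \<Rightarrow> nat \<Rightarrow> real \<Rightarrow> real \<Rightarrow> nat \<Rightarrow> real \<Rightarrow> real" where
  "maim_f r k A \<delta> s \<omega> =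
     A * ((1 + (-1) ^ k) / 2 + (1 + (-1) ^ (k + 1)) / 2 * sg k \<delta> (\<omega> - opt_weight r s))"

(* The five types of adaptive control functions, each carrying its own parameters:
   MAIM1 m with m s = m_s, MAIM2 Q CFS with CFS s = CFS_s, MAIM5 C. *)
datatype maim_type =
    MAIM1 "nat \<Rightarrow> real"
  | MAIM2 real "nat \<Rightarrow> real"
  | MAIM3
  | MAIM4
  | MAIM5 real

definition maim_q :: "nat \<Rightarrow> nat \<Rightarrow> real \<Rightarrow> real" where
  "maim_q r s \<omega> = (\<omega> - opt_weight r s) *
     (opt_weight r s / \<omega>\<^sup>2 * (1 - ln \<omega>)
      + (1 - opt_weight r s) / (1 - \<omega>)\<^sup>2 * (ln (1 - \<omega>) - 1))"

(* For s < r, where 0 < d_s < 1, maim_q r s is continuous on the open unit interval and tends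
   to minus infinity at both ends, so the supremum below is the maximum. *)
fun admissible :: "nat \<Rightarrow> nat \<Rightarrow> maim_type \<Rightarrow> bool" where
  "admissible r k (MAIM1 m) \<longleftrightarrow>
     (\<exists>M>0. \<exists>\<alpha>. \<forall>s<r. \<alpha> s > max 0 (SUP \<omega>\<in>{0<..<1}. maim_q r s \<omega>) \<and>
        \<alpha> s / (real k + 1) \<le> m s \<and> m s < M)"
| "admissible r k (MAIM2 Q CFS) \<longleftrightarrow>
     Q \<ge> 1 / real k \<and> (\<forall>s<r. 0 < CFS s \<and> CFS s \<le> opt_weight r s)"
| "admissible r k MAIM3 \<longleftrightarrow> True"
| "admissible r k MAIM4 \<longleftrightarrow> True"
| "admissible r k (MAIM5 C) \<longleftrightarrow> C \<ge> 1"

(* ada0 and ada1 are the exponents f^Ada0_{i,s} and f^Ada1_{i,s} at \<omega>; the functions b and w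
   supply the smoothness indicators and the WENO-JS weights of the cell under consideration. *)
fun ada0 :: "nat \<Rightarrow> nat \<Rightarrow> maim_type \<Rightarrow> (nat \<Rightarrow> real) \<Rightarrow> (nat \<Rightarrow> real) \<Rightarrow> nat \<Rightarrow> real \<Rightarrow> real" where
  "ada0 r k (MAIM1 m) b w s \<omega> = opt_weight r s / (m s * \<omega>)"
| "ada0 r k (MAIM2 Q CFS) b w s \<omega> =
     (if CFS s < \<omega> \<and> \<omega> < 1 - (1 - opt_weight r s) / opt_weight r s * CFS s
      then 1 else Q * real k)"
| "ada0 r k MAIM3 b w s \<omega> = Max (b ` {..<r}) / Min (b ` {..<r})"
| "ada0 r k MAIM4 b w s \<omega> =
     Max ((\<lambda>l. w l / opt_weight r l) ` {..<r}) / Min ((\<lambda>l. w l / opt_weight r l) ` {..<r})"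
| "ada0 r k (MAIM5 C) b w s \<omega> = C"

fun ada1 :: "nat \<Rightarrow> nat \<Rightarrow> maim_type \<Rightarrow> (nat \<Rightarrow> real) \<Rightarrow> (nat \<Rightarrow> real) \<Rightarrow> nat \<Rightarrow> real \<Rightarrow> real" where
  "ada1 r k (MAIM1 m) b w s \<omega> = (1 - opt_weight r s) / (m s * (1 - \<omega>))"
| "ada1 r k (MAIM2 Q CFS) b w s \<omega> = ada0 r k (MAIM2 Q CFS) b w s \<omega>"
| "ada1 r k MAIM3 b w s \<omega> = ada0 r k MAIM3 b w s \<omega>"
| "ada1 r k MAIM4 b w s \<omega> = ada0 r k MAIM4 b w s \<omega>"
| "ada1 r k (MAIM5 C) b w s \<omega> = ada0 r k (MAIM5 C) b w s \<omega>"

definition maim_map ::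
    "nat \<Rightarrow> nat \<Rightarrow> real \<Rightarrow> real \<Rightarrow> maim_type \<Rightarrow> (nat \<Rightarrow> real) \<Rightarrow> (nat \<Rightarrow> real) \<Rightarrow> nat \<Rightarrow> real \<Rightarrow> real" where
  "maim_map r k A \<delta> T b w s \<omega> =
     opt_weight r s +
     maim_f r k A \<delta> s \<omega> * (\<omega> - opt_weight r s) ^ (k + 1) /
     (maim_f r k A \<delta> s \<omega> * (\<omega> - opt_weight r s) ^ k
      + \<omega> powr (ada0 r k T b w s \<omega>) * (1 - \<omega>) powr (ada1 r k T b w s \<omega>))"

definition maim_alpha ::
    "nat \<Rightarrow> nat \<Rightarrow> real \<Rightarrow> real \<Rightarrow> maim_type \<Rightarrow> real \<Rightarrow> (real \<Rightarrow> real) \<Rightarrow> real \<Rightarrow> real \<Rightarrow> int \<Rightarrow> nat \<Rightarrow> real" where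
  "maim_alpha r k A \<delta> T eps u x0 h j s =
     maim_map r k A \<delta> T (smooth_ind r u x0 h j) (js_weight r eps u x0 h j) s
       (js_weight r eps u x0 h j s)"

definition maim_weight ::
    "nat \<Rightarrow> nat \<Rightarrow> real \<Rightarrow> real \<Rightarrow> maim_type \<Rightarrow> real \<Rightarrow> (real \<Rightarrow> real) \<Rightarrow> real \<Rightarrow> real \<Rightarrow> int \<Rightarrow> nat \<Rightarrow> real" where
  "maim_weight r k A \<delta> T eps u x0 h j s =
     maim_alpha r k A \<delta> T eps u x0 h j s / (\<Sum>l<r. maim_alpha r k A \<delta> T eps u x0 h j l)"

(* The reconstructed value u^-_{j+1/2}; u^-_{j-1/2} is the value at j - 1. *)
definition maim_recon ::
    "nat \<Rightarrow> nat \<Rightarrow> real \<Rightarrow> real \<Rightarrow> maim_type \<Rightarrow> real \<Rightarrow> (real \<Rightarrow> real) \<Rightarrow> real \<Rightarrow> real \<Rightarrow> int \<Rightarrow> real" where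
  "maim_recon r k A \<delta> T eps u x0 h j =
     (\<Sum>s<r. maim_weight r k A \<delta> T eps u x0 h j s * cand_value r u x0 h j s)"

definition k_maim :: "nat \<Rightarrow> nat \<Rightarrow> real" where
  "k_maim r n = (let K = \<lceil>real r / (real r - 1 - real n) - 2\<rceil>
                 in of_int K + (1 + (-1) powi K) / 2)"

end

theory Submission imports Defs begin

text \<open>The error of an edge value splits into that of the linear reconstruction with the optimal weights,
which largely cancels between the two edges of a cell, and a product of two small quantities: the
deviation of the nonlinear weights from the optimal ones and the spread of the candidate values. The
bounds are uniform in the position of the grid because they hold at any edge \<open>e\<close> with
\<open>\<bar>e - x*\<bar> \<le> h\<close>, as both edges of a cell containing \<open>x*\<close> are.

The linear scheme. On each stencil the candidate polynomial is a linear function of the cell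
averages that reproduces polynomials of degree below \<open>r\<close> (lemma \<open>cand_poly_eq_avg_recon\<close>). The
combination with the optimal weights reproduces polynomials of degree at most \<open>2r - 2\<close> (lemma
\<open>opt_recon_exact\<close>): it is Vandermonde's convolution applied to the \<open>r\<close>-th finite differences on the
stencils, which add up to a finite difference of order \<open>2r - 1\<close>. Its defect on a polynomial of degree
\<open>2r - 1\<close> is then invariant under translation by one cell (lemma \<open>opt_recon_defect_shift\<close>), hence
cancels in the difference of the two edge values. This cancellation gains the power of \<open>h\<close> that the
division by \<open>h\<close> costs.

The weights. Let \<open>n\<close> be the order of the critical point. The derivatives of a candidate, scaled by
powers of \<open>h\<close>, agree with those of the Taylor polynomial up to \<open>O(h^r)\<close>, while the latter are
\<open>O(h^(n+1))\<close>; and since \<open>u^(n+1)(x*)\<close> does not vanish, the smoothness indicator of the Taylor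
polynomial is at least a multiple of \<open>h^(2n+2)\<close>. So all indicators on a cell agree up to a relative
error \<open>O(h^(r-1-n))\<close> (lemma \<open>smooth_ind_relative_spread\<close>), and adding \<open>\<epsilon>\<close> to each of them can only
decrease that relative error. Therefore the WENO-JS weights differ from the optimal ones by
\<open>O(h^(r-1-n))\<close>.

The mapping. Near the optimal weight, all five kinds of exponents are bounded, so the term
\<open>\<omega>^a (1-\<omega>)^b\<close> in the denominator is bounded below, and the mapping is flat there of order \<open>k + 1\<close>
for even \<open>k\<close>, and of order \<open>k + 2\<close> for odd \<open>k\<close>, when the smoothed sign contributes one more factor
(lemma \<open>maim_map_flat\<close>). The bound on \<open>k\<close> says precisely that this order times \<open>r - 1 - n\<close> is at least
\<open>r\<close> (lemma \<open>k_maim_flat_order\<close>). So the mapped weights are within \<open>O(h^r)\<close> of the optimal ones; as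
the candidates differ from each other by \<open>O(h^r)\<close> as well, the nonlinear reconstruction differs from
the linear one by \<open>O(h^(2r))\<close>.\<close>

section \<open>Polynomials on an equidistant grid\<close>

text \<open>Translation preserves the leading coefficient.\<close>

lemma degree_translate_diff_less:
  fixes p :: "real poly"
  assumes "degree p \<le> n" and "0 < n"
  shows "degree (pcompose p [:c, 1:] - p) < n"
proof (cases "degree p = n")
  case True
  let ?d = "pcompose p [:c, 1:] - p"
  have deg: "degree (pcompose p [:c, 1:]) = n"
    using True by (simp add: degree_pcompose)
  have "coeff (pcompose p [:c, 1:]) n = coeff p n"
    using lead_coeff_comp[of "[:c, 1:]" p] deg True by simp
  then have "coeff ?d n = 0" by simp
  moreover have "degree ?d \<le> n" using degree_diff_le[of _ n p] deg True by simp
  ultimately show ?thesis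
    using assms(2) by (metis degree_0 le_neq_implies_less leading_coeff_0_iff)
next
  case False
  then show ?thesis
    using assms degree_diff_le_max[of "pcompose p [:c, 1:]" p]
    by (simp add: degree_pcompose)
qed

text \<open>The sum is, up to sign, the \<open>n\<close>-th finite difference, and each difference lowers the degree.\<close>

lemma alternating_binomial_sum_poly_eq_0:
  fixes p :: "real poly"
  assumes "degree p < n"
  shows "(\<Sum>i\<le>n. (-1) ^ i * real (n choose i) * poly p (a + real i * h)) = 0"
  using assms
proof (induction n arbitrary: p)
  case 0
  then show ?case by simp
next
  case (Suc n)
  let ?F = "\<lambda>i. poly p (a + real i * h)"
  let ?q = "pcompose p [:h, 1:] - p"
  have q: "poly ?q (a + real i * h) = ?F (Suc i) - ?F i" for i
    by (simp add: poly_pcompose algebra_simps)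
  have split: "(\<Sum>i\<le>Suc n. (-1) ^ i * real (Suc n choose i) * ?F i)
      = - (\<Sum>i\<le>n. (-1) ^ i * real (n choose i) * (?F (Suc i) - ?F i))"
  proof -
    have "(\<Sum>i\<le>Suc n. (-1) ^ i * real (Suc n choose i) * ?F i)
        = ?F 0 + (\<Sum>i\<le>n. (-1) ^ Suc i * real (Suc n choose Suc i) * ?F (Suc i))"
      by (subst sum.atMost_Suc_shift) simp
    also have "\<dots> = (?F 0 + (\<Sum>i\<le>n. (-1) ^ Suc i * real (n choose Suc i) * ?F (Suc i)))
        - (\<Sum>i\<le>n. (-1) ^ i * real (n choose i) * ?F (Suc i))"
    proof -
      have "(\<Sum>i\<le>n. (-1) ^ Suc i * real (Suc n choose Suc i) * ?F (Suc i))
          = (\<Sum>i\<le>n. (-1) ^ Suc i * real (n choose Suc i) * ?F (Suc i)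
              - (-1) ^ i * real (n choose i) * ?F (Suc i))"
        by (intro sum.cong) (simp_all add: ring_distribs del: of_nat_Suc)
      then show ?thesis by (simp only: sum_subtractf)
    qed
    also have "?F 0 + (\<Sum>i\<le>n. (-1) ^ Suc i * real (n choose Suc i) * ?F (Suc i))
        = (\<Sum>i\<le>Suc n. (-1) ^ i * real (n choose i) * ?F i)"
      by (subst sum.atMost_Suc_shift) simp
    also have "\<dots> = (\<Sum>i\<le>n. (-1) ^ i * real (n choose i) * ?F i)"
      by simp
    finally show ?thesis
      by (simp add: sum_subtractf algebra_simps)
  qed
  show ?case
  proof (cases "n = 0")
    case True
    with Suc.prems obtain c where "p = [:c:]" by (auto elim: degree_eq_zeroE)
    then show ?thesis using True by simp
  next
    case False
    have "degree ?q < n"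
      using Suc.prems False by (intro degree_translate_diff_less) auto
    from Suc.IH[OF this] show ?thesis
      unfolding split q by simp
  qed
qed

lemma poly_antiderivative_exists:
  fixes p :: "real poly"
  shows "\<exists>P. pderiv P = p \<and> degree P \<le> Suc (degree p)"
proof -
  let ?P = "\<Sum>i\<le>degree p. monom (coeff p i / real (Suc i)) (Suc i)"
  have "pderiv ?P = (\<Sum>i\<le>degree p. monom (coeff p i) i)"
    unfolding higher_pderiv_sum[of 1, simplified]
    by (intro sum.cong) (simp_all add: pderiv_monom del: of_nat_Suc)
  also have "\<dots> = p" by (rule poly_as_sum_of_monoms)
  finally have "pderiv ?P = p" .
  moreover have "degree ?P \<le> Suc (degree p)"
    by (intro degree_sum_le) (auto intro: order.trans[OF degree_monom_le])
  ultimately show ?thesis by blast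
qed

lemma poly_interpolation_exists:
  fixes f :: "real \<Rightarrow> real"
  assumes "finite A" "A \<noteq> {}"
  shows "\<exists>p. degree p < card A \<and> (\<forall>x\<in>A. poly p x = f x)"
  using assms
proof (induction A rule: finite_ne_induct)
  case (singleton x)
  show ?case by (intro exI[of _ "[:f x:]"]) simp
next
  case (insert x A)
  then obtain p where p: "degree p < card A" "\<forall>y\<in>A. poly p y = f y" by blast
  let ?w = "\<Prod>y\<in>A. [:- y, 1:]"
  let ?q = "p + smult ((f x - poly p x) / poly ?w x) ?w"
  have w: "poly ?w y = (\<Prod>z\<in>A. y - z)" for y by (simp add: poly_prod)
  have wx: "poly ?w x \<noteq> 0" using insert w by (simp add: prod_zero_iff) 
  have "degree ?w = card A"
    by (subst degree_prod_sum_eq) auto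
  then have "degree ?q \<le> card A"
    using p(1) by (intro degree_add_le) (auto intro: order.trans[OF degree_smult_le])
  moreover have "poly ?q y = f y" if "y \<in> insert x A" for y
  proof (cases "y = x")
    case True then show ?thesis using wx by simp
  next
    case False
    then have "y \<in> A" using that by simp
    moreover from this have "poly ?w y = 0" using insert(1) w by (auto simp: prod_zero_iff)
    ultimately show ?thesis using p(2) by simp
  qed
  ultimately show ?case using insert by (intro exI[of _ ?q]) auto
qed

section \<open>Reconstruction from cell averages\<close>

text \<open>Cells are counted by naturals from the left end \<open>e\<close> of a stencil, which need not be an edge of the
given grid; this frees the interpolation theory from the integer cell index.\<close>

definition step_avg :: "(real \<Rightarrow> real) \<Rightarrow> real \<Rightarrow> real \<Rightarrow> nat \<Rightarrow> real" where
  "step_avg f e h i = (1 / h) * integral {e + real i * h .. e + real (Suc i) * h} f"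

lemma integral_poly_antiderivative:
  fixes P :: "real poly"
  assumes "a \<le> b"
  shows "integral {a..b} (poly (pderiv P)) = poly P b - poly P a"
  using assms
  by (intro integral_unique fundamental_theorem_of_calculus)
     (auto simp: has_real_derivative_iff_has_vector_derivative[symmetric]
           intro!: DERIV_subset[OF poly_DERIV])

lemma step_avg_pderiv:
  assumes "0 < h"
  shows "step_avg (poly (pderiv P)) e h i
    = (poly P (e + real (Suc i) * h) - poly P (e + real i * h)) / h"
proof -
  have "e + real i * h \<le> e + real (Suc i) * h" using assms by (simp add: algebra_simps)
  from integral_poly_antiderivative[OF this, of P] show ?thesis
    by (simp add: step_avg_def)
qed

text \<open>An antiderivative takes the same value at the \<open>r + 1\<close> end points of the cells, but has degree at
most \<open>r\<close>.\<close>

lemma poly_eq_0_if_step_avgs_eq_0: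
  fixes p :: "real poly"
  assumes "0 < h" "degree p < r" "\<And>i. i < r \<Longrightarrow> step_avg (poly p) e h i = 0"
  shows "p = 0"
proof -
  obtain P where P: "pderiv P = p" "degree P \<le> Suc (degree p)"
    using poly_antiderivative_exists by blast
  let ?x = "\<lambda>i. e + real i * h"
  have step: "poly P (?x (Suc i)) = poly P (?x i)" if "i < r" for i
    using assms(3)[OF that] step_avg_pderiv[OF assms(1), of P e i] P(1) assms(1) by simp
  have const: "poly P (?x i) = poly P e" if "i \<le> r" for i
    using that
  proof (induction i)
    case (Suc i)
    then show ?case using step[of i] by simp
  qed simp
  let ?Q = "P - [:poly P e:]"
  have "?Q = 0"
  proof (rule ccontr)
    assume nz: "?Q \<noteq> 0"
    have "inj_on ?x {..r}" using assms(1) by (auto simp: inj_on_def)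
    then have "card (?x ` {..r}) = Suc r" by (simp add: card_image)
    moreover have "?x ` {..r} \<subseteq> {x. poly ?Q x = 0}" using const by auto
    ultimately have "Suc r \<le> card {x. poly ?Q x = 0}"
      using poly_roots_finite[OF nz] by (metis card_mono)
    also have "\<dots> \<le> degree ?Q" by (rule card_poly_roots_bound[OF nz])
    also have "\<dots> \<le> r"
      using P(2) assms(2) by (intro degree_diff_le) auto
    finally show False by simp
  qed
  then have "pderiv ?Q = 0" by simp
  then show ?thesis using P(1) by (simp add: pderiv_diff pderiv_pCons)
qed

text \<open>The dual basis of the averages over the unit cells \<open>[0,1], \<dots>, [r-1,r]\<close>, in the polynomials of
degree below \<open>r\<close>. Working on this fixed reference stencil makes all later constants independent of the
grid.\<close>

definition cell_basis :: "nat \<Rightarrow> nat \<Rightarrow> real poly" where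
  "cell_basis r i = (SOME p. degree p < r \<and>
     (\<forall>m<r. step_avg (poly p) 0 1 m = (if m = i then 1 else 0)))"

lemma cell_basis:
  assumes "0 < r"
  shows "degree (cell_basis r i) < r"
    and "m < r \<Longrightarrow> step_avg (poly (cell_basis r i)) 0 1 m = (if m = i then 1 else 0)"
proof -
  let ?A = "real ` {..r}"
  have card: "card ?A = Suc r" by (simp add: card_image)
  \<comment> \<open>The basis polynomial is the derivative of an interpolant of a step function with its step at cell \<open>i\<close>.\<close>
  obtain P where P: "degree P < card ?A"
      "\<forall>x\<in>?A. poly P x = (if x \<le> real i then 0 else 1)"
    using poly_interpolation_exists[of ?A "\<lambda>x. if x \<le> real i then 0 else 1"] by auto
  have "degree (pderiv P) < r"
    using P(1) card assms by (simp add: degree_pderiv)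
  moreover have "step_avg (poly (pderiv P)) 0 1 m = (if m = i then 1 else 0)" if "m < r" for m
  proof -
    have "real m \<in> ?A" "real (Suc m) \<in> ?A" using that by (auto simp del: of_nat_Suc)
    then have "poly P (real m) = (if m \<le> i then 0 else 1)"
      "poly P (real (Suc m)) = (if Suc m \<le> i then 0 else 1)"
      using P(2) by (auto simp del: of_nat_Suc)
    then show ?thesis by (auto simp: step_avg_pderiv)
  qed
  ultimately have "\<exists>p. degree p < r \<and>
      (\<forall>m<r. step_avg (poly p) 0 1 m = (if m = i then 1 else 0))" by blast
  then have "degree (cell_basis r i) < r \<and>
      (\<forall>m<r. step_avg (poly (cell_basis r i)) 0 1 m = (if m = i then 1 else 0))"
    unfolding cell_basis_def by (rule someI_ex)
  then show "degree (cell_basis r i) < r"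
    "m < r \<Longrightarrow> step_avg (poly (cell_basis r i)) 0 1 m = (if m = i then 1 else 0)" by auto
qed

text \<open>The reference basis, moved to the stencil with left end point \<open>e\<close>. In contrast to a definite
description, this form is visibly linear in the averages.\<close>

definition avg_recon :: "nat \<Rightarrow> (real \<Rightarrow> real) \<Rightarrow> real \<Rightarrow> real \<Rightarrow> real poly" where
  "avg_recon r f e h =
     (\<Sum>i<r. smult (step_avg f e h i) (pcompose (cell_basis r i) [:- (e / h), 1 / h:]))"

lemma step_avg_rescale:
  assumes "0 < h"
  shows "step_avg (poly (pcompose p [:- (e / h), 1 / h:])) e h i = step_avg (poly p) 0 1 i"
proof -
  obtain P where P: "pderiv P = p" using poly_antiderivative_exists by blast
  have "pcompose p [:- (e / h), 1 / h:]
      = pderiv (smult h (pcompose P [:- (e / h), 1 / h:]))"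
    using assms P by (simp add: pderiv_smult pderiv_pcompose pderiv_pCons)
  then have "step_avg (poly (pcompose p [:- (e / h), 1 / h:])) e h i
     = (poly (smult h (pcompose P [:- (e / h), 1 / h:])) (e + real (Suc i) * h)
       - poly (smult h (pcompose P [:- (e / h), 1 / h:])) (e + real i * h)) / h"
    using step_avg_pderiv[OF assms] by simp
  also have "\<dots> = poly P (real (Suc i)) - poly P (real i)"
  proof -
    have "- (e / h) + (e + real m * h) / h = real m" for m
      using assms by (simp add: field_simps)
    then show ?thesis
      using assms by (simp add: poly_pcompose right_diff_distrib[symmetric] del: of_nat_Suc)
  qed
  also have "\<dots> = step_avg (poly p) 0 1 i"
    using step_avg_pderiv[of 1 P 0 i] P by simp
  finally show ?thesis .
qed

lemma step_avg_sum:
  assumes "finite A" "\<And>k. k \<in> A \<Longrightarrow> f k integrable_on {e + real i * h .. e + real (Suc i) * h}"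
  shows "step_avg (\<lambda>x. \<Sum>k\<in>A. c k * f k x) e h i = (\<Sum>k\<in>A. c k * step_avg (f k) e h i)"
  unfolding step_avg_def using assms
  by (subst integral_sum) (auto simp: sum_distrib_left algebra_simps intro!: integrable_on_mult_right)

lemma step_avg_diff:
  assumes "f integrable_on {e + real i * h .. e + real (Suc i) * h}"
    and "g integrable_on {e + real i * h .. e + real (Suc i) * h}"
  shows "step_avg (\<lambda>x. f x - g x) e h i = step_avg f e h i - step_avg g e h i"
  unfolding step_avg_def using assms by (subst integral_diff) (auto simp: right_diff_distrib)

lemma step_avg_avg_recon:
  assumes "0 < h" "m < r"
  shows "step_avg (poly (avg_recon r f e h)) e h m = step_avg f e h m"
proof -
  let ?b = "\<lambda>i. pcompose (cell_basis r i) [:- (e / h), 1 / h:]"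
  have "poly (avg_recon r f e h) = (\<lambda>x. \<Sum>i<r. step_avg f e h i * poly (?b i) x)"
    by (auto simp: avg_recon_def poly_sum)
  then have "step_avg (poly (avg_recon r f e h)) e h m
      = (\<Sum>i<r. step_avg f e h i * step_avg (poly (?b i)) e h m)"
    by (simp only:) (intro step_avg_sum integrable_continuous_real continuous_intros; simp)
  also have "\<dots> = (\<Sum>i<r. step_avg f e h i * (if m = i then 1 else 0))"
    using assms by (intro sum.cong) (auto simp: step_avg_rescale[OF assms(1)] cell_basis(2))
  also have "\<dots> = step_avg f e h m" using assms by (simp add: if_distrib cong: if_cong)
  finally show ?thesis .
qed

lemma degree_avg_recon:
  assumes "0 < r"
  shows "degree (avg_recon r f e h) < r"
proof -
  have "degree (pcompose (cell_basis r i) [:- (e / h), 1 / h:]) \<le> r - 1" for i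
    using cell_basis(1)[OF assms, of i] by (auto simp: degree_pcompose)
  then have "degree (avg_recon r f e h) \<le> r - 1"
    unfolding avg_recon_def
    by (intro degree_sum_le) (auto intro: order.trans[OF degree_smult_le])
  then show ?thesis using assms by simp
qed

lemma avg_recon_unique:
  assumes "0 < h" "degree p < r" "\<And>i. i < r \<Longrightarrow> step_avg (poly p) e h i = step_avg f e h i"
  shows "p = avg_recon r f e h"
proof -
  let ?R = "avg_recon r f e h"
  have "degree (p - ?R) < r"
    using assms(2) degree_avg_recon[of r f e h] by (metis degree_diff_less gr_zeroI not_less0)
  moreover have "step_avg (poly (p - ?R)) e h i = 0" if "i < r" for i
  proof -
    have "step_avg (poly (p - ?R)) e h i = step_avg (poly p) e h i - step_avg (poly ?R) e h i"
      unfolding poly_diff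
      by (intro step_avg_diff integrable_continuous_real continuous_intros)
    then show ?thesis using assms that by (simp add: step_avg_avg_recon)
  qed
  ultimately have "p - ?R = 0" using poly_eq_0_if_step_avgs_eq_0[OF assms(1)] by blast
  then show ?thesis by simp
qed

lemma edge_shift: "edge x0 h (j + i) = edge x0 h j + of_int i * h"
  by (simp add: edge_def algebra_simps)

lemma cell_avg_eq_step_avg:
  "cell_avg f x0 h (j + 1 + int i) = step_avg f (edge x0 h j) h i"
proof -
  have "j + 1 + int i - 1 = j + int i" by simp
  then have "cell x0 h (j + 1 + int i) = {edge x0 h j + real i * h .. edge x0 h j + real (Suc i) * h}"
    using edge_shift[of x0 h j "1 + int i"] edge_shift[of x0 h j "int i"]
    unfolding cell_def by (simp add: add.assoc)
  then show ?thesis by (simp add: cell_avg_def step_avg_def)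
qed

lemma cand_poly_eq_avg_recon:
  assumes "0 < h" "0 < r"
  shows "cand_poly r u x0 h j s = avg_recon r u (edge x0 h j + (real s - real r) * h) h"
proof -
  let ?e = "edge x0 h j + (real s - real r) * h"
  have e: "edge x0 h (j + int s - int r) = ?e"
    using edge_shift[of x0 h j "int s - int r"] by (simp add: algebra_simps)
  have avg: "cell_avg f x0 h (j + int s - int r + 1 + int i) = step_avg f ?e h i" for f i
    using cell_avg_eq_step_avg[of f x0 h "j + int s - int r" i] e by simp
  have cells: "(\<forall>i \<in> {j + int s - int r + 1 .. j + int s}. Q i)
      \<longleftrightarrow> (\<forall>i<r. Q (j + int s - int r + 1 + int i))" for Q
  proof
    assume *: "\<forall>i<r. Q (j + int s - int r + 1 + int i)"
    show "\<forall>i \<in> {j + int s - int r + 1 .. j + int s}. Q i"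
    proof
      fix i assume i: "i \<in> {j + int s - int r + 1 .. j + int s}"
      then have "nat (i - (j + int s - int r + 1)) < r" by auto
      from *[rule_format, OF this] i show "Q i" by simp
    qed
  qed auto
  show ?thesis
    unfolding cand_poly_def cells avg
  proof (rule the_equality)
    show "degree (avg_recon r u ?e h) \<le> r - 1 \<and>
      (\<forall>i<r. step_avg (poly (avg_recon r u ?e h)) ?e h i = step_avg u ?e h i)"
      using degree_avg_recon[OF assms(2), of u ?e h] assms step_avg_avg_recon by auto
  next
    fix p assume "degree p \<le> r - 1 \<and> (\<forall>i<r. step_avg (poly p) ?e h i = step_avg u ?e h i)"
    then show "p = avg_recon r u ?e h"
      using assms by (intro avg_recon_unique) auto
  qed
qed

section \<open>The optimal weights\<close>

lemma opt_weight_eq: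
  assumes "s < r"
  shows "opt_weight r s = real ((r choose (r - s)) * ((r - 1) choose s)) / real ((2 * r - 1) choose r)"
  using assms by (simp add: opt_weight_def binomial_symmetric[of s r])

lemma opt_weight_pos: "s < r \<Longrightarrow> 0 < opt_weight r s"
  by (simp add: opt_weight_def)

lemma sum_opt_weight:
  assumes "0 < r"
  shows "(\<Sum>s<r. opt_weight r s) = 1"
proof -
  have "(\<Sum>s<r. (r choose (r - s)) * ((r - 1) choose s))
      = (\<Sum>s\<le>r. ((r - 1) choose s) * (r choose (r - s)))"
    using assms by (intro sum.mono_neutral_cong_left) (auto simp: not_less)
  also have "\<dots> = (2 * r - 1) choose r"
    using assms by (subst vandermonde) (simp add: mult_2)
  finally have "(\<Sum>s<r. (r choose (r - s)) * ((r - 1) choose s)) = (2 * r - 1) choose r" .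
  then have "(\<Sum>s<r. real ((r choose (r - s)) * ((r - 1) choose s))) = real ((2 * r - 1) choose r)"
    by (metis of_nat_sum)
  moreover have "(\<Sum>s<r. opt_weight r s)
      = (\<Sum>s<r. real ((r choose (r - s)) * ((r - 1) choose s))) / real ((2 * r - 1) choose r)"
    by (subst sum_divide_distrib) (intro sum.cong, auto simp: opt_weight_eq)
  ultimately show ?thesis using assms by simp
qed

lemma opt_weight_less_1:
  assumes "2 \<le> r" "s < r"
  shows "opt_weight r s < 1"
proof -
  \<comment> \<open>Another index: the remaining positive weight keeps this one below the sum.\<close>
  define t where "t = (if s = 0 then 1 else 0 :: nat)"
  have t: "t < r" "t \<noteq> s" using assms by (auto simp: t_def)
  have "opt_weight r s + opt_weight r t = (\<Sum>l\<in>{s, t}. opt_weight r l)" using t by simp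
  also have "\<dots> \<le> (\<Sum>l<r. opt_weight r l)"
    using assms t opt_weight_pos by (intro sum_mono2) (auto intro: less_imp_le)
  also have "\<dots> = 1" using assms by (intro sum_opt_weight) auto
  finally show ?thesis using opt_weight_pos[OF t(1)] by linarith
qed

text \<open>The linear reconstruction at \<open>e\<close>; its stencil number \<open>s\<close> begins \<open>r - s\<close> cells to the left of \<open>e\<close>.\<close>

definition opt_recon :: "nat \<Rightarrow> (real \<Rightarrow> real) \<Rightarrow> real \<Rightarrow> real \<Rightarrow> real" where
  "opt_recon r f e h =
     (\<Sum>s<r. opt_weight r s * poly (avg_recon r f (e + (real s - real r) * h) h) e)"

text \<open>Dividing \<open>p - p(e)\<close> by \<open>X - e\<close> turns derivative values at \<open>e\<close> into point values of \<open>G\<close>, to which finite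
differences apply.\<close>

lemma poly_split_root:
  fixes p :: "real poly"
  obtains G where "p = [:poly p e:] + [:- e, 1:] * G" "poly G e = poly (pderiv p) e"
    "degree G \<le> degree p - 1"
proof -
  have "poly (p - [:poly p e:]) e = 0" by simp
  then obtain G where G: "p - [:poly p e:] = [:- e, 1:] * G"
    unfolding poly_eq_0_iff_dvd by (elim dvdE)
  then have p: "p = [:poly p e:] + [:- e, 1:] * G" by (metis add.commute diff_add_cancel)
  have "poly (pderiv p) e = poly G e"
    by (subst p) (simp add: pderiv_add pderiv_diff pderiv_smult pderiv_pCons)
  moreover have "degree G \<le> degree p - 1"
  proof (cases "G = 0")
    case False
    then have "degree ([:- e, 1:] * G) = Suc (degree G)" by (subst degree_mult_eq) auto
    moreover have "degree (p - [:poly p e:]) \<le> degree p" by (intro degree_diff_le) auto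
    ultimately show ?thesis using G by simp
  qed simp
  ultimately show thesis using p that by metis
qed

text \<open>The error of one candidate is an \<open>r\<close>-th finite difference. Antiderivatives of the candidate and of
\<open>q\<close> agree, up to a constant, at all nodes of the stencil, one of which is \<open>e\<close>. So their difference
quotients at \<open>e\<close>, extended by the derivative at \<open>e\<close>, agree at all nodes except \<open>e\<close> itself, where they
differ by the error of the candidate. The quotient of the candidate has degree below \<open>r\<close>, hence a
vanishing \<open>r\<close>-th difference.\<close>

lemma poly_avg_recon_stencil_defect:
  fixes q :: "real poly"
  assumes "0 < h" "s < r" "q = pderiv Q" "Q = [:poly Q e:] + [:- e, 1:] * G"
  shows "real (r choose (r - s))
      * (poly (avg_recon r (poly q) (e + (real s - real r) * h) h) e - poly G e)
    = (-1) ^ (r - s + 1) * (\<Sum>i\<le>r. (-1) ^ i * real (r choose i) * poly G (e + (real s - real r) * h + real i * h))"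
proof -
  let ?a = "e + (real s - real r) * h"
  let ?x = "\<lambda>i. ?a + real i * h"
  let ?p = "avg_recon r (poly q) ?a h"
  have r: "0 < r" using assms(2) by simp
  obtain P where P: "pderiv P = ?p" "degree P \<le> Suc (degree ?p)"
    using poly_antiderivative_exists by blast
  then have degP: "degree P \<le> r" using degree_avg_recon[OF r, of "poly q" ?a h] by simp
  have step: "poly P (?x (Suc i)) - poly P (?x i) = poly Q (?x (Suc i)) - poly Q (?x i)"
    if "i < r" for i
    using step_avg_avg_recon[OF assms(1) that, of "poly q" ?a]
      step_avg_pderiv[OF assms(1), of P ?a i] step_avg_pderiv[OF assms(1), of Q ?a i]
      P(1) assms(1,3) by (simp del: of_nat_Suc)
  have telescope: "poly P (?x i) - poly Q (?x i) = poly P (?x 0) - poly Q (?x 0)" if "i \<le> r" for i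
    using that
  proof (induction i)
    case (Suc i)
    then show ?case using step[of i] by simp
  qed simp
  have xe: "?x (r - s) = e" using assms(2) by (simp add: of_nat_diff algebra_simps)
  obtain Gs where Gs: "P = [:poly P e:] + [:- e, 1:] * Gs" "poly Gs e = poly ?p e"
      "degree Gs \<le> degree P - 1"
    using poly_split_root[of P e] P(1) by metis
  have eq: "poly Gs (?x i) = poly G (?x i)" if "i \<le> r" "i \<noteq> r - s" for i
  proof -
    have "?x i - e = (real i - real (r - s)) * h" using assms(2) by (simp add: of_nat_diff algebra_simps)
    then have nz: "?x i - e \<noteq> 0" using that assms(1) by simp
    have "poly P (?x i) - poly P e = poly Q (?x i) - poly Q e"
      using telescope[OF that(1)] telescope[of "r - s"] unfolding xe by simp
    moreover have "poly P (?x i) - poly P e = (?x i - e) * poly Gs (?x i)"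
      by (subst Gs(1)) (simp add: algebra_simps)
    moreover have "poly Q (?x i) - poly Q e = (?x i - e) * poly G (?x i)"
      by (subst assms(4)) (simp add: algebra_simps)
    ultimately show ?thesis using nz by simp
  qed
  let ?c = "\<lambda>i. (-1) ^ i * real (r choose i)"
  have "(\<Sum>i\<le>r. ?c i * poly Gs (?x i)) = 0"
    using Gs(3) degP r by (intro alternating_binomial_sum_poly_eq_0) simp
  then have "(\<Sum>i\<le>r. ?c i * poly G (?x i)) = (\<Sum>i\<le>r. ?c i * (poly G (?x i) - poly Gs (?x i)))"
    by (simp add: sum_subtractf right_diff_distrib)
  also have "\<dots> = (\<Sum>i\<in>{r - s}. ?c i * (poly G (?x i) - poly Gs (?x i)))"
    using eq by (intro sum.mono_neutral_right) auto
  also have "\<dots> = ?c (r - s) * (poly G (?x (r - s)) - poly Gs (?x (r - s)))" by simp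
  also have "\<dots> = ?c (r - s) * (poly G e - poly ?p e)" unfolding xe Gs(2) ..
  finally have "(-1) ^ (r - s + 1) * (\<Sum>i\<le>r. ?c i * poly G (?x i))
      = (-1) ^ (r - s + 1) * ?c (r - s) * (poly G e - poly ?p e)" by simp
  also have "(-1) ^ (r - s + 1) * ?c (r - s) = - real (r choose (r - s))"
    by (simp add: power_mult_distrib[symmetric] mult.assoc[symmetric])
  finally show ?thesis by (simp add: algebra_simps)
qed

text \<open>The stencil errors multiplied by \<open>binomial(r-1, s)\<close> are the terms of a Vandermonde convolution: their
sum is a finite difference of order \<open>2r - 1\<close> of a polynomial of degree at most \<open>2r - 2\<close>.\<close>

lemma opt_recon_exact:
  fixes q :: "real poly"
  assumes "0 < h" "0 < r" "degree q \<le> 2 * r - 2"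
  shows "opt_recon r (poly q) e h = poly q e"
proof -
  obtain Q where Q: "pderiv Q = q" "degree Q \<le> Suc (degree q)"
    using poly_antiderivative_exists by blast
  obtain G where G: "Q = [:poly Q e:] + [:- e, 1:] * G" "poly G e = poly q e" "degree G \<le> degree Q - 1"
    using poly_split_root[of Q e] Q(1) by metis
  have degG: "degree G < 2 * r - 1" using G(3) Q(2) assms by simp
  let ?B = "real ((2 * r - 1) choose r)"
  let ?p = "\<lambda>s. poly (avg_recon r (poly q) (e + (real s - real r) * h) h) e"
  let ?y = "\<lambda>m. e - real r * h + real m * h"
  let ?g = "\<lambda>m. (-1) ^ m * poly G (?y m)"
  have inner: "real (r choose (r - s)) * (?p s - poly q e)
      = (-1) ^ (r + 1) * (\<Sum>m\<in>{s..s + r}. real (r choose (m - s)) * ?g m)" if "s < r" for s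
  proof -
    have "real (r choose (r - s)) * (?p s - poly q e)
      = (-1) ^ (r - s + 1) * (\<Sum>i\<le>r. (-1) ^ i * real (r choose i) * poly G (e + (real s - real r) * h + real i * h))"
      using poly_avg_recon_stencil_defect[OF assms(1) that Q(1)[symmetric] G(1)] G(2) by simp
    also have "(\<Sum>i\<le>r. (-1) ^ i * real (r choose i) * poly G (e + (real s - real r) * h + real i * h))
       = (-1) ^ s * (\<Sum>i\<le>r. real (r choose i) * ?g (s + i))"
      by (subst sum_distrib_left, intro sum.cong)
         (auto simp: algebra_simps power_add power_mult_distrib[symmetric])
    also have "(\<Sum>i\<le>r. real (r choose i) * ?g (s + i))
       = (\<Sum>m\<in>{s..s + r}. real (r choose (m - s)) * ?g m)"
      by (rule sum.reindex_bij_witness[of _ "\<lambda>m. m - s" "\<lambda>i. s + i"]) auto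
    also have "(-1) ^ (r - s + 1) * ((-1) ^ s * X) = (-1) ^ (r + 1) * X" for X :: real
      using that by (simp add: power_add[symmetric] mult.assoc[symmetric])
    finally show ?thesis .
  qed
  have ext: "(\<Sum>m\<in>{s..s + r}. real (r choose (m - s)) * ?g m)
      = (\<Sum>m\<le>2 * r - 1. real (if s \<le> m then r choose (m - s) else 0) * ?g m)" if "s < r" for s
    using that by (intro sum.mono_neutral_cong_left) auto
  have vand: "(\<Sum>s<r. ((r - 1) choose s) * (if s \<le> m then r choose (m - s) else 0)) = (2 * r - 1) choose m" for m
  proof -
    have "(\<Sum>s<r. ((r - 1) choose s) * (if s \<le> m then r choose (m - s) else 0))
        = (\<Sum>s\<in>{..m} \<inter> {..<r}. ((r - 1) choose s) * (r choose (m - s)))"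
      by (intro sum.mono_neutral_cong_right) auto
    also have "\<dots> = (\<Sum>s\<le>m. ((r - 1) choose s) * (r choose (m - s)))"
      using assms(2) by (intro sum.mono_neutral_left) auto
    also have "\<dots> = (2 * r - 1) choose m"
      using assms(2) by (subst vandermonde) (simp add: mult_2)
    finally show ?thesis .
  qed
  have "?B * (opt_recon r (poly q) e h - poly q e)
      = ?B * (\<Sum>s<r. opt_weight r s * (?p s - poly q e))"
    using sum_opt_weight[OF assms(2)]
    by (simp add: opt_recon_def right_diff_distrib sum_subtractf sum_distrib_right[symmetric])
  also have "\<dots> = (\<Sum>s<r. real ((r - 1) choose s) * (real (r choose (r - s)) * (?p s - poly q e)))"
    by (subst sum_distrib_left, intro sum.cong) (auto simp: opt_weight_eq)
  also have "\<dots> = (\<Sum>s<r. \<Sum>m\<le>2 * r - 1. (-1) ^ (r + 1) *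
      (real (((r - 1) choose s) * (if s \<le> m then r choose (m - s) else 0)) * ?g m))"
  proof (intro sum.cong refl)
    fix s assume "s \<in> {..<r}"
    then have s: "s < r" by simp
    show "real ((r - 1) choose s) * (real (r choose (r - s)) * (?p s - poly q e))
      = (\<Sum>m\<le>2 * r - 1. (-1) ^ (r + 1) *
        (real (((r - 1) choose s) * (if s \<le> m then r choose (m - s) else 0)) * ?g m))"
      unfolding inner[OF s] ext[OF s] by (simp only: sum_distrib_left of_nat_mult mult_ac)
  qed
  also have "\<dots> = (\<Sum>m\<le>2 * r - 1. (-1) ^ (r + 1) *
      (real (\<Sum>s<r. ((r - 1) choose s) * (if s \<le> m then r choose (m - s) else 0)) * ?g m))"
    by (subst sum.swap) (simp only: of_nat_sum sum_distrib_left sum_distrib_right)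
  also have "\<dots> = (-1) ^ (r + 1) * (\<Sum>m\<le>2 * r - 1. (-1) ^ m * real ((2 * r - 1) choose m) * poly G (?y m))"
    unfolding vand by (simp only: sum_distrib_left mult_ac)
  also have "\<dots> = 0"
    using alternating_binomial_sum_poly_eq_0[OF degG, of "e - real r * h" h] by simp
  finally have "?B * (opt_recon r (poly q) e h - poly q e) = 0" .
  moreover have "?B \<noteq> 0" using assms(2) by simp
  ultimately show ?thesis by simp
qed

lemma poly_avg_recon:
  "poly (avg_recon r f e h) x = (\<Sum>i<r. step_avg f e h i * poly (cell_basis r i) ((x - e) / h))"
  by (simp add: avg_recon_def poly_sum poly_pcompose diff_divide_distrib)

lemma poly_avg_recon_edge:
  assumes "0 < h"
  shows "poly (avg_recon r f (e + (real s - real r) * h) h) e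
    = (\<Sum>i<r. step_avg f (e + (real s - real r) * h) h i * poly (cell_basis r i) (real r - real s))"
proof -
  have "(e - (e + (real s - real r) * h)) / h = real r - real s"
    using assms by (simp add: field_simps)
  then show ?thesis by (simp only: poly_avg_recon)
qed

lemma step_avg_translate:
  fixes p :: "real poly"
  assumes "0 < h"
  shows "step_avg (poly (pcompose p [:c, 1:])) e h i = step_avg (poly p) (e + c) h i"
proof -
  obtain P where P: "pderiv P = p" using poly_antiderivative_exists by blast
  have "pderiv (pcompose P [:c, 1:]) = pcompose p [:c, 1:]"
    by (simp add: pderiv_pcompose P pderiv_pCons)
  then show ?thesis
    using step_avg_pderiv[OF assms, of "pcompose P [:c, 1:]" e i]
      step_avg_pderiv[OF assms, of P "e + c" i] P
    by (simp add: poly_pcompose add_ac)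
qed

text \<open>The difference of \<open>p\<close> and its translate has degree at most \<open>2r - 2\<close>, so the reconstruction is exact
on it.\<close>

lemma opt_recon_defect_shift:
  fixes p :: "real poly"
  assumes "0 < h" "0 < r" "degree p \<le> 2 * r - 1"
  shows "opt_recon r (poly p) (e - h) h - poly p (e - h) = opt_recon r (poly p) e h - poly p e"
proof -
  let ?p' = "pcompose p [:- h, 1:]"
  have "degree (?p' - p) \<le> 2 * r - 2"
    using degree_translate_diff_less[of p "2 * r - 1" "- h"] assms by simp
  then have "opt_recon r (poly (?p' - p)) e h = poly (?p' - p) e"
    using opt_recon_exact assms by blast
  moreover have "step_avg (poly (?p' - p)) (e + (real s - real r) * h) h i
      = step_avg (poly p) (e - h + (real s - real r) * h) h i
      - step_avg (poly p) (e + (real s - real r) * h) h i" for s i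
    unfolding poly_diff
    by (subst step_avg_diff)
       (auto simp: step_avg_translate[OF assms(1)] algebra_simps
             intro!: integrable_continuous_real continuous_intros)
  then have "opt_recon r (poly (?p' - p)) e h = opt_recon r (poly p) (e - h) h - opt_recon r (poly p) e h"
    unfolding opt_recon_def poly_avg_recon_edge[OF assms(1)]
    by (simp add: left_diff_distrib right_diff_distrib sum_subtractf)
  ultimately show ?thesis by (simp add: poly_pcompose)
qed

section \<open>Consistency of the candidate reconstructions\<close>

lemma higher_pderiv_pcompose_linear:
  fixes p :: "real poly"
  shows "(pderiv ^^ l) (pcompose p [:a, b:]) = smult (b ^ l) (pcompose ((pderiv ^^ l) p) [:a, b:])"
proof (induction l)
  case (Suc l)
  then show ?case
    by (simp add: pderiv_smult pderiv_pcompose pderiv_pCons mult.commute)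
qed simp

lemma higher_pderiv_avg_recon:
  assumes "0 < h"
  shows "h ^ l * poly ((pderiv ^^ l) (avg_recon r f e h)) x
    = (\<Sum>i<r. step_avg f e h i * poly ((pderiv ^^ l) (cell_basis r i)) ((x - e) / h))"
  using assms
  by (simp add: avg_recon_def higher_pderiv_sum higher_pderiv_smult higher_pderiv_pcompose_linear
      poly_sum poly_pcompose sum_distrib_left diff_divide_distrib power_divide mult_ac)

lemma step_avg_bound:
  assumes "0 < h" "f integrable_on {e + real i * h .. e + real (Suc i) * h}"
    and "\<And>x. x \<in> {e + real i * h .. e + real (Suc i) * h} \<Longrightarrow> \<bar>f x\<bar> \<le> B"
  shows "\<bar>step_avg f e h i\<bar> \<le> B"
proof -
  have le: "e + real i * h \<le> e + real (Suc i) * h" using assms(1) by (simp add: algebra_simps)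
  then have "0 \<le> B" using assms(3)[of "e + real i * h"] by auto
  have "norm (integral {e + real i * h .. e + real (Suc i) * h} f)
      \<le> B * measure lborel {e + real i * h .. e + real (Suc i) * h}"
    by (rule has_integral_bound_real[OF \<open>0 \<le> B\<close> finite.emptyI integrable_integral[OF assms(2)]])
       (use assms(3) in auto)
  also have "\<dots> = B * h" using le by (simp add: algebra_simps)
  finally show ?thesis using assms(1) by (simp add: step_avg_def abs_mult field_simps)
qed

text \<open>Since \<open>p\<close> is its own reconstruction, the error is a combination of averages of \<open>f - p\<close> whose
coefficients are derivatives of the reference basis on the compact interval \<open>[0, r]\<close>. The factor
\<open>h^l\<close> is exactly what the chain rule produces.\<close>

lemma avg_recon_stability:
  assumes "0 < r"
  shows "\<exists>K\<ge>0. \<forall>h e f p \<epsilon> l x. 0 < h \<longrightarrow> degree p < r \<longrightarrow> l \<le> r \<longrightarrow> continuous_on {e..e + real r * h} f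
     \<longrightarrow> (\<forall>y\<in>{e..e + real r * h}. \<bar>f y - poly p y\<bar> \<le> \<epsilon>) \<longrightarrow> x \<in> {e..e + real r * h}
     \<longrightarrow> \<bar>h ^ l * poly ((pderiv ^^ l) (avg_recon r f e h)) x - h ^ l * poly ((pderiv ^^ l) p) x\<bar> \<le> K * \<epsilon>"
proof -
  let ?g = "\<lambda>l i y. poly ((pderiv ^^ l) (cell_basis r i)) y"
  have "\<exists>K. \<forall>y\<in>{0..real r}. \<bar>?g l i y\<bar> \<le> K" for l i
  proof -
    have "bounded (?g l i ` {0..real r})"
      by (intro compact_imp_bounded compact_continuous_image continuous_intros) auto
    then show ?thesis by (auto simp: bounded_iff)
  qed
  then obtain K where K: "\<And>l i y. y \<in> {0..real r} \<Longrightarrow> \<bar>?g l i y\<bar> \<le> K l i" by metis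
  have K0: "0 \<le> K l i" for l i using K[of 0 l i] by (auto intro: order.trans[OF abs_ge_zero])
  define K' where "K' = (\<Sum>l\<le>r. \<Sum>i<r. K l i)"
  have "0 \<le> K'" unfolding K'_def by (intro sum_nonneg K0)
  moreover have "\<bar>h ^ l * poly ((pderiv ^^ l) (avg_recon r f e h)) x - h ^ l * poly ((pderiv ^^ l) p) x\<bar> \<le> K' * \<epsilon>"
    if h: "0 < h" and p: "degree p < r" and l: "l \<le> r" and f: "continuous_on {e..e + real r * h} f"
      and fp: "\<forall>y\<in>{e..e + real r * h}. \<bar>f y - poly p y\<bar> \<le> \<epsilon>" and x: "x \<in> {e..e + real r * h}"
    for h e f p \<epsilon> l x
  proof -
    have eps: "0 \<le> \<epsilon>" using fp x by (metis abs_ge_zero order.trans)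
    have sub: "{e + real i * h .. e + real (Suc i) * h} \<subseteq> {e..e + real r * h}" if "i < r" for i
    proof -
      have "real (Suc i) * h \<le> real r * h" using that h by (intro mult_right_mono) auto
      then show ?thesis using h by (auto intro: order.trans[rotated])
    qed
    have int: "f integrable_on {e + real i * h .. e + real (Suc i) * h}" if "i < r" for i
      by (intro integrable_continuous_real continuous_on_subset[OF f] sub that)
    have intp: "poly p integrable_on {e + real i * h .. e + real (Suc i) * h}" for i
      by (intro integrable_continuous_real continuous_intros)
    have avg: "\<bar>step_avg f e h i - step_avg (poly p) e h i\<bar> \<le> \<epsilon>" if "i < r" for i
    proof -
      have "\<bar>step_avg (\<lambda>x. f x - poly p x) e h i\<bar> \<le> \<epsilon>"
        using fp sub[OF that] by (intro step_avg_bound h integrable_diff int that intp) auto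
      then show ?thesis using step_avg_diff[OF int[OF that] intp] by simp
    qed
    \<comment> \<open>Polynomials of degree below \<open>r\<close> are reproduced, so the error depends on \<open>f - p\<close> only.\<close>
    have pr: "p = avg_recon r (poly p) e h" using h p by (intro avg_recon_unique) auto
    have "h ^ l * poly ((pderiv ^^ l) (avg_recon r f e h)) x - h ^ l * poly ((pderiv ^^ l) p) x
        = (\<Sum>i<r. (step_avg f e h i - step_avg (poly p) e h i) * ?g l i ((x - e) / h))"
      by (subst pr) (simp add: higher_pderiv_avg_recon[OF h] sum_subtractf left_diff_distrib)
    also have "\<bar>\<dots>\<bar> \<le> (\<Sum>i<r. \<epsilon> * K l i)"
    proof (intro order.trans[OF sum_abs] sum_mono)
      fix i assume "i \<in> {..<r}"
      then have "i < r" by simp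
      have "(x - e) / h \<in> {0..real r}" using x h by (auto simp: field_simps)
      then show "\<bar>(step_avg f e h i - step_avg (poly p) e h i) * ?g l i ((x - e) / h)\<bar> \<le> \<epsilon> * K l i"
        unfolding abs_mult using avg[OF \<open>i < r\<close>] K by (intro mult_mono) (auto simp: eps)
    qed
    also have "\<dots> = (\<Sum>i<r. K l i) * \<epsilon>" by (simp add: sum_distrib_left mult.commute)
    also have "(\<Sum>i<r. K l i) \<le> K'"
      unfolding K'_def using l by (intro member_le_sum sum_nonneg K0) auto
    finally show ?thesis using eps by (simp add: mult_right_mono)
  qed
  ultimately show ?thesis by blast
qed

definition taylor_poly :: "(real \<Rightarrow> real) \<Rightarrow> real \<Rightarrow> nat \<Rightarrow> real poly" where
  "taylor_poly u a n = (\<Sum>m<n. smult ((deriv ^^ m) u a / fact m) ([:- a, 1:] ^ m))"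

lemma degree_taylor_poly: "0 < n \<Longrightarrow> degree (taylor_poly u a n) < n"
proof -
  assume "0 < n"
  have "degree (taylor_poly u a n) \<le> n - 1"
    unfolding taylor_poly_def
    by (intro degree_sum_le) (auto simp: degree_linear_power)
  then show ?thesis using \<open>0 < n\<close> by simp
qed

lemma taylor_poly_altdef:
  "taylor_poly u a n = pcompose (\<Sum>m<n. monom ((deriv ^^ m) u a / fact m) m) [:- a, 1:]"
proof -
  have "pcompose (monom c m) q = smult c (q ^ m)" for c :: real and m q
  proof (induction m)
    case 0 then show ?case by (simp add: monom_0)
  next
    case (Suc m) then show ?case by (simp add: monom_Suc pcompose_pCons)
  qed
  then show ?thesis by (simp add: taylor_poly_def pcompose_sum)
qed

lemma higher_pderiv_taylor_poly:
  "poly ((pderiv ^^ l) (taylor_poly u a n)) a = (if l < n then (deriv ^^ l) u a else 0)"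
proof -
  let ?q = "\<Sum>m<n. monom ((deriv ^^ m) u a / fact m) m"
  have c: "coeff ?q l = (if l < n then (deriv ^^ l) u a / fact l else 0)"
    by (simp add: coeff_sum coeff_monom)
  have "poly ((pderiv ^^ l) (taylor_poly u a n)) a = coeff ((pderiv ^^ l) ?q) 0"
    by (simp add: taylor_poly_altdef higher_pderiv_pcompose_linear poly_pcompose poly_0_coeff_0)
  also have "\<dots> = fact l * coeff ?q l"
    by (simp add: coeff_higher_pderiv pochhammer_fact)
  finally show ?thesis by (simp add: c)
qed

lemma smooth_near_taylor:
  assumes "smooth_near u a"
  obtains \<rho> where "0 < \<rho>" "continuous_on {a - \<rho>..a + \<rho>} u"
    and "\<And>n. 0 < n \<Longrightarrow> \<exists>C\<ge>0. \<forall>x\<in>{a - \<rho>..a + \<rho>}. \<bar>u x - poly (taylor_poly u a n) x\<bar> \<le> C * \<bar>x - a\<bar> ^ n"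
proof -
  obtain S where S: "open S" "a \<in> S" "\<And>n y. y \<in> S \<Longrightarrow> (deriv ^^ n) u field_differentiable (at y)"
    using assms unfolding smooth_near_def by blast
  obtain \<rho> where \<rho>: "0 < \<rho>" "cball a \<rho> \<subseteq> S" using S(1,2) open_contains_cball by blast
  have ball: "cball a \<rho> = {a - \<rho>..a + \<rho>}" by (auto simp: cball_def dist_real_def)
  have der: "DERIV ((deriv ^^ n) u) t :> (deriv ^^ Suc n) u t" if "t \<in> {a - \<rho>..a + \<rho>}" for n t
    using S(3)[of t n] that \<rho>(2) unfolding ball
    by (auto simp: DERIV_deriv_iff_field_differentiable)
  have cont: "continuous_on {a - \<rho>..a + \<rho>} ((deriv ^^ n) u)" for n
    using der by (intro continuous_at_imp_continuous_on ballI DERIV_isCont) auto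
  have "\<exists>C\<ge>0. \<forall>x\<in>{a - \<rho>..a + \<rho>}. \<bar>u x - poly (taylor_poly u a n) x\<bar> \<le> C * \<bar>x - a\<bar> ^ n"
    if n: "0 < n" for n
  proof -
    have "bounded ((deriv ^^ n) u ` {a - \<rho>..a + \<rho>})"
      by (intro compact_imp_bounded compact_continuous_image cont) auto
    then obtain K where K: "\<And>x. x \<in> {a - \<rho>..a + \<rho>} \<Longrightarrow> \<bar>(deriv ^^ n) u x\<bar> \<le> K"
      unfolding bounded_iff by (metis image_eqI real_norm_def)
    have K0: "0 \<le> K" using K[of a] \<rho>(1) by (auto intro: order.trans[OF abs_ge_zero])
    have T: "poly (taylor_poly u a n) x = (\<Sum>m<n. (deriv ^^ m) u a / fact m * (x - a) ^ m)" for x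
      by (simp add: taylor_poly_def poly_sum poly_power)
    have "\<bar>u x - poly (taylor_poly u a n) x\<bar> \<le> K / fact n * \<bar>x - a\<bar> ^ n"
      if x: "x \<in> {a - \<rho>..a + \<rho>}" for x
    proof (cases "x = a")
      case True
      have "poly (taylor_poly u a n) a = u a"
        using higher_pderiv_taylor_poly[of 0 u a n] n by simp
      then show ?thesis using True K0 by simp
    next
      case False
      obtain t where t: "if x < a then x < t \<and> t < a else a < t \<and> t < x"
        and u: "u x = (\<Sum>m<n. (deriv ^^ m) u a / fact m * (x - a) ^ m) + (deriv ^^ n) u t / fact n * (x - a) ^ n"
        using Taylor[OF n, of "\<lambda>m. (deriv ^^ m) u" u "a - \<rho>" "a + \<rho>" a x] der \<rho>(1) x False
        by auto
      have "t \<in> {a - \<rho>..a + \<rho>}" using t x \<rho>(1) by (auto split: if_splits)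
      then show ?thesis
        using K[of t] unfolding u T
        by (auto simp: abs_mult power_abs intro!: mult_right_mono divide_right_mono)
    qed
    then show ?thesis using K0 by (intro exI[of _ "K / fact n"]) auto
  qed
  moreover have "continuous_on {a - \<rho>..a + \<rho>} u" using cont[of 0] by simp
  ultimately show thesis using \<rho>(1) that by blast
qed

lemma stencil_within:
  fixes a e h y :: real
  assumes "0 < h" "\<bar>e - a\<bar> \<le> h" "s < r" "y \<in> {e + (real s - real r) * h .. e + (real s - real r) * h + real r * h}"
  shows "\<bar>y - a\<bar> \<le> (real r + 1) * h"
proof -
  have "0 \<le> real s * h" "real s * h \<le> real r * h" using assms by (auto intro: mult_right_mono)
  moreover have "e + real s * h - real r * h \<le> y" "y \<le> e + real s * h"
    using assms(4) by (simp_all add: algebra_simps)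
  ultimately show ?thesis using assms(2) unfolding distrib_right by linarith
qed

lemma cell_subset_stencil:
  fixes e h :: real
  assumes "0 < h" "s < r"
  shows "{e - h .. e} \<subseteq> {e + (real s - real r) * h .. e + (real s - real r) * h + real r * h}"
proof -
  have "real (Suc s) * h \<le> real r * h" "0 \<le> real s * h" using assms by (auto intro!: mult_right_mono simp del: of_nat_Suc)
  then show ?thesis by (auto simp: algebra_simps)
qed

lemma eventually_mult_power_less_at_right_0:
  fixes K \<rho> :: real
  assumes "0 < \<rho>" "0 < m"
  shows "\<forall>\<^sub>F h in at_right 0. K * h ^ m < \<rho>"
proof -
  have "((\<lambda>h. K * h ^ m) \<longlongrightarrow> K * 0 ^ m) (at_right 0)" by (intro tendsto_intros)
  then show ?thesis using assms by (simp add: order_tendsto_iff power_0_left)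
qed

lemma eventually_mult_less_at_right_0:
  fixes K \<rho> :: real
  assumes "0 < \<rho>"
  shows "\<forall>\<^sub>F h in at_right 0. K * h < \<rho>"
  using eventually_mult_power_less_at_right_0[OF assms, of 1 K] by simp

text \<open>For small \<open>h\<close> all stencils lie in the interval on which Taylor's estimate holds.\<close>

lemma eventually_stencil_taylor:
  assumes "smooth_near u a" "0 < N"
  shows "\<exists>C. \<forall>\<^sub>F h in at_right 0. \<forall>e s. \<bar>e - a\<bar> \<le> h \<longrightarrow> s < r \<longrightarrow>
     continuous_on {e + (real s - real r) * h .. e + (real s - real r) * h + real r * h} u \<and>
     (\<forall>y\<in>{e + (real s - real r) * h .. e + (real s - real r) * h + real r * h}.
        \<bar>u y - poly (taylor_poly u a N) y\<bar> \<le> C * h ^ N)"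
proof -
  obtain \<rho> where \<rho>: "0 < \<rho>" "continuous_on {a - \<rho>..a + \<rho>} u"
    and tay: "\<exists>C\<ge>0. \<forall>x\<in>{a - \<rho>..a + \<rho>}. \<bar>u x - poly (taylor_poly u a N) x\<bar> \<le> C * \<bar>x - a\<bar> ^ N"
    using smooth_near_taylor[OF assms(1)] assms(2) by metis
  obtain C where C: "0 \<le> C" "\<And>x. x \<in> {a - \<rho>..a + \<rho>} \<Longrightarrow> \<bar>u x - poly (taylor_poly u a N) x\<bar> \<le> C * \<bar>x - a\<bar> ^ N"
    using tay by blast
  have "\<forall>\<^sub>F h in at_right 0. \<forall>e s. \<bar>e - a\<bar> \<le> h \<longrightarrow> s < r \<longrightarrow>
     continuous_on {e + (real s - real r) * h .. e + (real s - real r) * h + real r * h} u \<and>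
     (\<forall>y\<in>{e + (real s - real r) * h .. e + (real s - real r) * h + real r * h}.
        \<bar>u y - poly (taylor_poly u a N) y\<bar> \<le> C * (real r + 1) ^ N * h ^ N)"
    using eventually_mult_less_at_right_0[OF \<rho>(1), of "real r + 1"] eventually_at_right_less[of 0]
  proof eventually_elim
    case (elim h)
    show ?case
    proof (intro allI impI)
      fix e s
      assume near: "\<bar>e - a\<bar> \<le> h" and s: "s < r"
      let ?S = "{e + (real s - real r) * h .. e + (real s - real r) * h + real r * h}"
      have dist: "\<bar>y - a\<bar> \<le> (real r + 1) * h" if "y \<in> ?S" for y
        by (rule stencil_within[OF elim(2) near s that])
      have sub: "?S \<subseteq> {a - \<rho>..a + \<rho>}"
      proof
        fix y assume "y \<in> ?S"
        from dist[OF this] elim(1) show "y \<in> {a - \<rho>..a + \<rho>}" by auto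
      qed
      have "\<bar>u y - poly (taylor_poly u a N) y\<bar> \<le> C * (real r + 1) ^ N * h ^ N" if "y \<in> ?S" for y
      proof -
        have "\<bar>u y - poly (taylor_poly u a N) y\<bar> \<le> C * \<bar>y - a\<bar> ^ N" using C(2) sub that by blast
        also have "\<dots> \<le> C * ((real r + 1) * h) ^ N"
          using dist[OF that] C(1) by (intro mult_left_mono power_mono) auto
        finally show ?thesis by (simp add: power_mult_distrib)
      qed
      then show "continuous_on ?S u \<and> (\<forall>y\<in>?S. \<bar>u y - poly (taylor_poly u a N) y\<bar> \<le> C * (real r + 1) ^ N * h ^ N)"
        using continuous_on_subset[OF \<rho>(2) sub] by blast
    qed
  qed
  then show ?thesis by blast
qed

lemma cand_poly_derivs_near_taylor:
  assumes "smooth_near u a" "0 < r"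
  shows "\<exists>C\<ge>0. \<forall>\<^sub>F h in at_right 0. \<forall>x0 j s l. \<forall>x\<in>{edge x0 h j - h .. edge x0 h j}.
     \<bar>edge x0 h j - a\<bar> \<le> h \<longrightarrow> s < r \<longrightarrow> l \<le> r \<longrightarrow>
     \<bar>h ^ l * poly ((pderiv ^^ l) (cand_poly r u x0 h j s)) x
       - h ^ l * poly ((pderiv ^^ l) (taylor_poly u a r)) x\<bar> \<le> C * h ^ r"
proof -
  obtain C where C: "\<forall>\<^sub>F h in at_right 0. \<forall>e s. \<bar>e - a\<bar> \<le> h \<longrightarrow> s < r \<longrightarrow>
     continuous_on {e + (real s - real r) * h .. e + (real s - real r) * h + real r * h} u \<and>
     (\<forall>y\<in>{e + (real s - real r) * h .. e + (real s - real r) * h + real r * h}.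
        \<bar>u y - poly (taylor_poly u a r) y\<bar> \<le> C * h ^ r)"
    using eventually_stencil_taylor[OF assms] by blast
  obtain K where K: "0 \<le> K" "\<And>h e f p \<epsilon> l x. 0 < h \<Longrightarrow> degree p < r \<Longrightarrow> l \<le> r \<Longrightarrow> continuous_on {e..e + real r * h} f
     \<Longrightarrow> (\<forall>y\<in>{e..e + real r * h}. \<bar>f y - poly p y\<bar> \<le> \<epsilon>) \<Longrightarrow> x \<in> {e..e + real r * h}
     \<Longrightarrow> \<bar>h ^ l * poly ((pderiv ^^ l) (avg_recon r f e h)) x - h ^ l * poly ((pderiv ^^ l) p) x\<bar> \<le> K * \<epsilon>"
    using avg_recon_stability[OF assms(2)] by blast
  have "\<forall>\<^sub>F h in at_right 0. \<forall>x0 j s l. \<forall>x\<in>{edge x0 h j - h .. edge x0 h j}.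
     \<bar>edge x0 h j - a\<bar> \<le> h \<longrightarrow> s < r \<longrightarrow> l \<le> r \<longrightarrow>
     \<bar>h ^ l * poly ((pderiv ^^ l) (cand_poly r u x0 h j s)) x
       - h ^ l * poly ((pderiv ^^ l) (taylor_poly u a r)) x\<bar> \<le> K * \<bar>C\<bar> * h ^ r"
    using C eventually_at_right_less[of 0]
  proof eventually_elim
    case (elim h)
    show ?case
    proof (intro allI ballI impI)
      fix x0 j s l x
      assume x: "x \<in> {edge x0 h j - h .. edge x0 h j}" and near: "\<bar>edge x0 h j - a\<bar> \<le> h"
        and s: "s < r" and l: "l \<le> r"
      let ?e = "edge x0 h j + (real s - real r) * h"
      have "x \<in> {?e..?e + real r * h}" using cell_subset_stencil[OF elim(2) s] x by blast
      from K(2)[OF elim(2) degree_taylor_poly[OF assms(2)] l _ _ this] elim(1) near s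
      have "\<bar>h ^ l * poly ((pderiv ^^ l) (avg_recon r u ?e h)) x
         - h ^ l * poly ((pderiv ^^ l) (taylor_poly u a r)) x\<bar> \<le> K * (C * h ^ r)" by blast
      also have "\<dots> \<le> K * (\<bar>C\<bar> * h ^ r)"
        using K(1) elim(2) by (intro mult_left_mono mult_right_mono) auto
      finally show "\<bar>h ^ l * poly ((pderiv ^^ l) (cand_poly r u x0 h j s)) x
         - h ^ l * poly ((pderiv ^^ l) (taylor_poly u a r)) x\<bar> \<le> K * \<bar>C\<bar> * h ^ r"
        using cand_poly_eq_avg_recon[OF elim(2) assms(2)] by (simp add: mult.assoc)
    qed
  qed
  then show ?thesis using K(1) by (intro exI[of _ "K * \<bar>C\<bar>"]) auto
qed

text \<open>Taken with \<open>N = 2 * r\<close>, this replaces \<open>u\<close> by a polynomial to which the cancellation between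
neighbouring edges applies.\<close>

lemma opt_recon_near_taylor:
  assumes "smooth_near u a" "0 < r" "0 < N"
  shows "\<exists>C. \<forall>\<^sub>F h in at_right 0. \<forall>e. \<bar>e - a\<bar> \<le> h \<longrightarrow>
     \<bar>opt_recon r u e h - opt_recon r (poly (taylor_poly u a N)) e h\<bar> \<le> C * h ^ N
     \<and> \<bar>u e - poly (taylor_poly u a N) e\<bar> \<le> C * h ^ N"
proof -
  let ?T = "taylor_poly u a N"
  obtain C where C: "\<forall>\<^sub>F h in at_right 0. \<forall>e s. \<bar>e - a\<bar> \<le> h \<longrightarrow> s < r \<longrightarrow>
     continuous_on {e + (real s - real r) * h .. e + (real s - real r) * h + real r * h} u \<and>
     (\<forall>y\<in>{e + (real s - real r) * h .. e + (real s - real r) * h + real r * h}.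
        \<bar>u y - poly ?T y\<bar> \<le> C * h ^ N)"
    using eventually_stencil_taylor[OF assms(1,3)] by blast
  define K where "K = (\<Sum>s<r. opt_weight r s * (\<Sum>i<r. \<bar>poly (cell_basis r i) (real r - real s)\<bar>))"
  have "\<forall>\<^sub>F h in at_right 0. \<forall>e. \<bar>e - a\<bar> \<le> h \<longrightarrow>
     \<bar>opt_recon r u e h - opt_recon r (poly ?T) e h\<bar> \<le> (\<bar>C\<bar> * K + \<bar>C\<bar>) * h ^ N
     \<and> \<bar>u e - poly ?T e\<bar> \<le> (\<bar>C\<bar> * K + \<bar>C\<bar>) * h ^ N"
    using C eventually_at_right_less[of 0]
  proof eventually_elim
    case (elim h)
    show ?case
    proof (intro allI impI)
      fix e assume near: "\<bar>e - a\<bar> \<le> h"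
      let ?e = "\<lambda>s. e + (real s - real r) * h"
      let ?L = "\<lambda>s i. poly (cell_basis r i) (real r - real s)"
      have K0: "0 \<le> K" unfolding K_def by (intro sum_nonneg mult_nonneg_nonneg) (auto intro: less_imp_le opt_weight_pos)
      have hN: "0 \<le> h ^ N" using elim(2) by simp
      have avg: "\<bar>step_avg u (?e s) h i - step_avg (poly ?T) (?e s) h i\<bar> \<le> \<bar>C\<bar> * h ^ N"
        if s: "s < r" and i: "i < r" for s i
      proof -
        let ?S = "{?e s .. ?e s + real r * h}"
        let ?I = "{?e s + real i * h .. ?e s + real (Suc i) * h}"
        have "real (Suc i) * h \<le> real r * h" "0 \<le> real i * h"
          using i elim(2) by (auto intro!: mult_right_mono simp del: of_nat_Suc)
        then have sub: "?I \<subseteq> ?S" by auto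
        have u: "continuous_on ?S u" "\<And>y. y \<in> ?S \<Longrightarrow> \<bar>u y - poly ?T y\<bar> \<le> C * h ^ N"
          using elim(1) near s by blast+
        have int: "u integrable_on ?I" "poly ?T integrable_on ?I"
          by (intro integrable_continuous_real continuous_on_subset[OF u(1)] sub)
             (intro integrable_continuous_real continuous_intros)
        have "\<bar>u y - poly ?T y\<bar> \<le> \<bar>C\<bar> * h ^ N" if "y \<in> ?I" for y
          using u(2)[OF subsetD[OF sub that]] mult_right_mono[OF abs_ge_self[of C] hN] by (rule order.trans)
        then have "\<bar>step_avg (\<lambda>y. u y - poly ?T y) (?e s) h i\<bar> \<le> \<bar>C\<bar> * h ^ N"
          by (rule step_avg_bound[OF elim(2) integrable_diff[OF int]])
        then show ?thesis using step_avg_diff[OF int] by simp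
      qed
      have diff: "opt_recon r u e h - opt_recon r (poly ?T) e h
          = (\<Sum>s<r. opt_weight r s * (\<Sum>i<r. (step_avg u (?e s) h i - step_avg (poly ?T) (?e s) h i) * ?L s i))"
        unfolding opt_recon_def poly_avg_recon_edge[OF elim(2)] sum_subtractf[symmetric]
          right_diff_distrib[symmetric] left_diff_distrib[symmetric] ..
      have "\<bar>opt_recon r u e h - opt_recon r (poly ?T) e h\<bar>
          \<le> (\<Sum>s<r. opt_weight r s * (\<Sum>i<r. \<bar>C\<bar> * h ^ N * \<bar>?L s i\<bar>))"
        unfolding diff
      proof (intro order.trans[OF sum_abs] sum_mono)
        fix s assume "s \<in> {..<r}"
        then have s: "s < r" by simp
        have "\<bar>\<Sum>i<r. (step_avg u (?e s) h i - step_avg (poly ?T) (?e s) h i) * ?L s i\<bar>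
            \<le> (\<Sum>i<r. \<bar>C\<bar> * h ^ N * \<bar>?L s i\<bar>)"
          by (intro order.trans[OF sum_abs] sum_mono) (auto simp: abs_mult intro!: mult_right_mono avg s)
        then show "\<bar>opt_weight r s * (\<Sum>i<r. (step_avg u (?e s) h i - step_avg (poly ?T) (?e s) h i) * ?L s i)\<bar>
            \<le> opt_weight r s * (\<Sum>i<r. \<bar>C\<bar> * h ^ N * \<bar>?L s i\<bar>)"
          using opt_weight_pos[OF s] by (simp add: abs_mult)
      qed
      also have "\<dots> = (\<Sum>s<r. (\<bar>C\<bar> * h ^ N) * (opt_weight r s * (\<Sum>i<r. \<bar>?L s i\<bar>)))"
        by (intro sum.cong refl) (simp only: sum_distrib_left mult_ac)
      also have "\<dots> = \<bar>C\<bar> * K * h ^ N"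
        unfolding K_def sum_distrib_left[symmetric] by (simp only: mult_ac)
      also have "\<dots> \<le> (\<bar>C\<bar> * K + \<bar>C\<bar>) * h ^ N" using hN by (simp add: algebra_simps)
      finally have 1: "\<bar>opt_recon r u e h - opt_recon r (poly ?T) e h\<bar> \<le> (\<bar>C\<bar> * K + \<bar>C\<bar>) * h ^ N" .
      have "e \<in> {?e 0 .. ?e 0 + real r * h}" using elim(2) by simp
      then have "\<bar>u e - poly ?T e\<bar> \<le> C * h ^ N" using elim(1) near assms(2) by blast
      also have "\<dots> \<le> (\<bar>C\<bar> * K + \<bar>C\<bar>) * h ^ N" 
        using mult_nonneg_nonneg[OF abs_ge_zero[of C] K0] by (intro mult_right_mono hN) linarith
      finally show "\<bar>opt_recon r u e h - opt_recon r (poly ?T) e h\<bar> \<le> (\<bar>C\<bar> * K + \<bar>C\<bar>) * h ^ N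
         \<and> \<bar>u e - poly ?T e\<bar> \<le> (\<bar>C\<bar> * K + \<bar>C\<bar>) * h ^ N" using 1 by blast
    qed
  qed
  then show ?thesis by blast
qed

section \<open>Smoothness indicators near a critical point\<close>

text \<open>The Jiang-Shu indicator, with the powers of \<open>h\<close> distributed so that each summand is the average over
\<open>[e - h, e]\<close> of the square of a derivative scaled by \<open>h^l\<close>, the quantity estimated so far. The
polynomial is a parameter in order to compare a candidate with the Taylor polynomial.\<close>

definition js_indicator :: "nat \<Rightarrow> real poly \<Rightarrow> real \<Rightarrow> real \<Rightarrow> real" where
  "js_indicator r p e h =
     (\<Sum>l = 1..r - 1. step_avg (\<lambda>x. (h ^ l * poly ((pderiv ^^ l) p) x)\<^sup>2) (e - h) h 0)"

lemma smooth_ind_eq_js_indicator: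
  assumes "0 < h"
  shows "smooth_ind r u x0 h j s = js_indicator r (cand_poly r u x0 h j s) (edge x0 h j) h"
  unfolding smooth_ind_def js_indicator_def
proof (intro sum.cong refl)
  fix l assume "l \<in> {1..r - 1}"
  then obtain m where m: "l = Suc m" by (cases l) auto
  let ?F = "\<lambda>x. (poly ((pderiv ^^ l) (cand_poly r u x0 h j s)) x)\<^sup>2"
  have cell: "cell x0 h j = {edge x0 h j - h + real 0 * h .. edge x0 h j - h + real (Suc 0) * h}"
    using edge_shift[of x0 h j "-1"] by (simp add: cell_def)
  have "h ^ (2 * l - 1) = (1 / h) * (h ^ l)\<^sup>2"
    using assms by (simp add: m power2_eq_square power_add[symmetric] mult_2)
  then show "h ^ (2 * l - 1) * integral (cell x0 h j) ?F
      = step_avg (\<lambda>x. (h ^ l * poly ((pderiv ^^ l) (cand_poly r u x0 h j s)) x)\<^sup>2) (edge x0 h j - h) h 0"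
    unfolding step_avg_def cell power_mult_distrib by (simp add: integral_mult_right)
qed

lemma step_avg_ge:
  assumes "0 < h" "f integrable_on {e..e + h}" "\<And>x. x \<in> {e..e + h} \<Longrightarrow> c \<le> f x"
  shows "c \<le> step_avg f e h 0"
proof -
  have "integral {e..e + h} (\<lambda>x. c) \<le> integral {e..e + h} f"
    using assms by (intro integral_le) auto
  then show ?thesis using assms(1) by (simp add: step_avg_def field_simps)
qed

lemma js_indicator_perturbation:
  assumes h: "0 < h" and \<epsilon>: "0 \<le> \<epsilon>"
    and diff: "\<And>l x. 1 \<le> l \<Longrightarrow> l < r \<Longrightarrow> x \<in> {e - h..e} \<Longrightarrow>
      \<bar>h ^ l * poly ((pderiv ^^ l) p) x - h ^ l * poly ((pderiv ^^ l) q) x\<bar> \<le> \<epsilon>"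
    and M: "0 \<le> M" and bound: "\<And>l x. 1 \<le> l \<Longrightarrow> l < r \<Longrightarrow> x \<in> {e - h..e} \<Longrightarrow>
      \<bar>h ^ l * poly ((pderiv ^^ l) q) x\<bar> \<le> M"
  shows "\<bar>js_indicator r p e h - js_indicator r q e h\<bar> \<le> real r * (\<epsilon> * (2 * M + \<epsilon>))"
proof -
  let ?f = "\<lambda>p l x. h ^ l * poly ((pderiv ^^ l) p) x"
  have sq: "\<bar>y\<^sup>2 - z\<^sup>2\<bar> \<le> \<epsilon> * (2 * M + \<epsilon>)" if "\<bar>y - z\<bar> \<le> \<epsilon>" "\<bar>z\<bar> \<le> M" for y z :: real
  proof -
    have "\<bar>y\<^sup>2 - z\<^sup>2\<bar> = \<bar>y - z\<bar> * \<bar>y + z\<bar>"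
      by (simp add: abs_mult[symmetric] power2_eq_square algebra_simps)
    also have "\<dots> \<le> \<epsilon> * (2 * M + \<epsilon>)" using that \<epsilon> by (intro mult_mono) auto
    finally show ?thesis .
  qed
  have term_bound: "\<bar>step_avg (\<lambda>x. (?f p l x)\<^sup>2) (e - h) h 0 - step_avg (\<lambda>x. (?f q l x)\<^sup>2) (e - h) h 0\<bar>
      \<le> \<epsilon> * (2 * M + \<epsilon>)" if l: "1 \<le> l" "l < r" for l
  proof -
    have int: "(\<lambda>x. (?f p l x)\<^sup>2) integrable_on {e - h + real 0 * h .. e - h + real (Suc 0) * h}" for p
      by (intro integrable_continuous_real continuous_intros)
    have "\<bar>step_avg (\<lambda>x. (?f p l x)\<^sup>2 - (?f q l x)\<^sup>2) (e - h) h 0\<bar> \<le> \<epsilon> * (2 * M + \<epsilon>)"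
      by (rule step_avg_bound[OF h integrable_diff[OF int int]])
         (use diff[OF l] bound[OF l] in \<open>auto intro!: sq\<close>)
    then show ?thesis using step_avg_diff[OF int int] by simp
  qed
  have "\<bar>js_indicator r p e h - js_indicator r q e h\<bar> \<le> (\<Sum>l = 1..r - 1. \<epsilon> * (2 * M + \<epsilon>))"
    unfolding js_indicator_def sum_subtractf[symmetric]
    by (intro order.trans[OF sum_abs] sum_mono term_bound) auto
  also have "\<dots> = real (r - 1) * (\<epsilon> * (2 * M + \<epsilon>))" by simp
  also have "\<dots> \<le> real r * (\<epsilon> * (2 * M + \<epsilon>))"
    using \<epsilon> M by (intro mult_right_mono) auto
  finally show ?thesis .
qed

lemma js_indicator_ge:
  assumes "0 < h" "1 \<le> m" "m < r" "0 \<le> c"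
    and "\<And>x. x \<in> {e - h..e} \<Longrightarrow> c \<le> \<bar>poly ((pderiv ^^ m) p) x\<bar>"
  shows "h ^ (2 * m) * c\<^sup>2 \<le> js_indicator r p e h"
proof -
  let ?F = "\<lambda>l x. (h ^ l * poly ((pderiv ^^ l) p) x)\<^sup>2"
  have int: "?F l integrable_on {e - h..e - h + h}" for l
    by (intro integrable_continuous_real continuous_intros)
  have "h ^ (2 * m) * c\<^sup>2 \<le> step_avg (?F m) (e - h) h 0"
  proof (intro step_avg_ge assms(1) int)
    fix x assume "x \<in> {e - h..e - h + h}"
    then have "c\<^sup>2 \<le> (poly ((pderiv ^^ m) p) x)\<^sup>2"
      using assms(4) assms(5)[of x] by (intro iffD1[OF abs_le_square_iff]) simp
    then show "h ^ (2 * m) * c\<^sup>2 \<le> (h ^ m * poly ((pderiv ^^ m) p) x)\<^sup>2"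
      using assms(1) mult_left_mono[of "c\<^sup>2" "(poly ((pderiv ^^ m) p) x)\<^sup>2" "(h ^ m)\<^sup>2"]
      by (simp add: power_mult_distrib power_even_eq)
  qed
  also have "\<dots> \<le> js_indicator r p e h"
    unfolding js_indicator_def
    using assms(2,3) by (intro member_le_sum step_avg_ge assms(1) int) auto
  finally show ?thesis .
qed

lemma pcompose_power: "pcompose (p ^ m) q = pcompose p q ^ m"
  by (induction m) (simp_all add: pcompose_mult pcompose_1)

text \<open>In the variable \<open>(x - a) / h\<close> the coefficient of degree \<open>m\<close> carries the factor \<open>h^m\<close>. The constant
coefficient disappears on differentiation, and the next \<open>n\<close> vanish because \<open>a\<close> is a critical point.\<close>

lemma taylor_poly_derivs_bound:
  assumes crit: "\<And>m. 1 \<le> m \<Longrightarrow> m \<le> n \<Longrightarrow> (deriv ^^ m) u a = 0"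
  shows "\<exists>M\<ge>0. \<forall>h x l. 0 < h \<longrightarrow> h \<le> 1 \<longrightarrow> \<bar>x - a\<bar> \<le> 2 * h \<longrightarrow> 1 \<le> l \<longrightarrow> l < r \<longrightarrow>
    \<bar>h ^ l * poly ((pderiv ^^ l) (taylor_poly u a r)) x\<bar> \<le> M * h ^ (n + 1)"
proof -
  let ?g = "\<lambda>l m y. poly ((pderiv ^^ l) ([:0, 1:] ^ m)) y :: real"
  let ?c = "\<lambda>m. (deriv ^^ m) u a / fact m"
  have "\<exists>K. \<forall>y\<in>{-2..2}. \<bar>?g l m y\<bar> \<le> K" for l m
  proof -
    have "bounded (?g l m ` {-2..2})"
      by (intro compact_imp_bounded compact_continuous_image continuous_intros) auto
    then show ?thesis by (auto simp: bounded_iff)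
  qed
  then obtain K where K: "\<And>l m y. y \<in> {-2..2} \<Longrightarrow> \<bar>?g l m y\<bar> \<le> K l m" by metis
  have K0: "0 \<le> K l m" for l m using K[of 0 l m] by (auto intro: order.trans[OF abs_ge_zero])
  define M where "M = (\<Sum>l<r. \<Sum>m<r. \<bar>?c m\<bar> * K l m)"
  have "0 \<le> M" unfolding M_def by (intro sum_nonneg mult_nonneg_nonneg K0) auto
  moreover have "\<bar>h ^ l * poly ((pderiv ^^ l) (taylor_poly u a r)) x\<bar> \<le> M * h ^ (n + 1)"
    if h: "0 < h" "h \<le> 1" and x: "\<bar>x - a\<bar> \<le> 2 * h" and l: "1 \<le> l" "l < r" for h x l
  proof -
    have y: "(x - a) / h \<in> {-2..2}" using x h by (auto simp: field_simps abs_le_iff)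
    have pcompose_idL: "pcompose [:0, 1:] [:b, c:] = [:b, c:]" for b c :: real
      by (simp add: pcompose_pCons)
    have scale: "[:- a, 1:] ^ m = smult (h ^ m) (pcompose ([:0, 1:] ^ m) [:- (a / h), 1 / h:])" for m
    proof -
      have lin: "[:- a, 1:] = smult h [:- (a / h), 1 / h:]" using h(1) by simp
      show ?thesis
        by (subst lin) (simp only: smult_power pcompose_power pcompose_idL)
    qed
    have expand: "h ^ l * poly ((pderiv ^^ l) (taylor_poly u a r)) x
        = (\<Sum>m<r. ?c m * h ^ m * ?g l m ((x - a) / h))"
      unfolding taylor_poly_def scale
      using h(1) by (simp add: higher_pderiv_sum higher_pderiv_smult higher_pderiv_pcompose_linear
        poly_sum poly_pcompose sum_distrib_left diff_divide_distrib power_divide mult_ac)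
    have "\<bar>h ^ l * poly ((pderiv ^^ l) (taylor_poly u a r)) x\<bar> \<le> (\<Sum>m<r. \<bar>?c m\<bar> * K l m * h ^ (n + 1))"
      unfolding expand
    proof (intro order.trans[OF sum_abs] sum_mono)
      fix m assume "m \<in> {..<r}"
      consider "m = 0" | "1 \<le> m" "m \<le> n" | "n + 1 \<le> m" by linarith
      then show "\<bar>?c m * h ^ m * ?g l m ((x - a) / h)\<bar> \<le> \<bar>?c m\<bar> * K l m * h ^ (n + 1)"
      proof cases
        case 1
        obtain l' where "l = Suc l'" using l by (cases l) auto
        then have "(pderiv ^^ l) (1 :: real poly) = 0" by (simp add: funpow_Suc_right del: funpow.simps)
        then show ?thesis using 1 K0[of l 0] h by simp
      next
        case 2
        then show ?thesis using crit by simp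
      next
        case 3
        then have "h ^ m \<le> h ^ (n + 1)" using h by (intro power_decreasing) auto
        then have "\<bar>?c m\<bar> * (h ^ m * \<bar>?g l m ((x - a) / h)\<bar>) \<le> \<bar>?c m\<bar> * (h ^ (n + 1) * K l m)"
          using K[OF y] h by (intro mult_left_mono mult_mono) auto
        then show ?thesis using h(1) by (simp add: abs_mult mult_ac)
      qed
    qed
    also have "\<dots> = (\<Sum>m<r. \<bar>?c m\<bar> * K l m) * h ^ (n + 1)" by (simp only: sum_distrib_right)
    also have "\<dots> \<le> M * h ^ (n + 1)"
      unfolding M_def using l h
      by (intro mult_right_mono member_le_sum sum_nonneg mult_nonneg_nonneg K0) auto
    finally show ?thesis .
  qed
  ultimately show ?thesis by blast
qed

text \<open>The witness is the indicator \<open>b\<close> of the Taylor polynomial of degree below \<open>r\<close>, which does not depend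
on \<open>s\<close>. A deviation of order \<open>h^r h^(n+1)\<close> from \<open>b\<close>, where \<open>b\<close> is at least a multiple of \<open>h^(2n+2)\<close>,
is a relative deviation of order \<open>h^(r-1-n)\<close>.\<close>

lemma smooth_ind_relative_spread:
  assumes u: "smooth_near u a" and n: "n + 1 < r"
    and crit: "\<And>m. 1 \<le> m \<Longrightarrow> m \<le> n \<Longrightarrow> (deriv ^^ m) u a = 0"
    and noncrit: "(deriv ^^ (n + 1)) u a \<noteq> 0"
  shows "\<exists>C\<ge>0. \<forall>\<^sub>F h in at_right 0. \<forall>x0 j. \<bar>edge x0 h j - a\<bar> \<le> h \<longrightarrow>
     (\<exists>b>0. \<forall>s<r. \<bar>smooth_ind r u x0 h j s - b\<bar> \<le> C * h ^ (r - 1 - n) * b)"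
proof -
  let ?T = "taylor_poly u a r"
  have r: "0 < r" using n by simp
  obtain C where C: "0 \<le> C" "\<forall>\<^sub>F h in at_right 0. \<forall>x0 j s l. \<forall>x\<in>{edge x0 h j - h .. edge x0 h j}.
     \<bar>edge x0 h j - a\<bar> \<le> h \<longrightarrow> s < r \<longrightarrow> l \<le> r \<longrightarrow>
     \<bar>h ^ l * poly ((pderiv ^^ l) (cand_poly r u x0 h j s)) x - h ^ l * poly ((pderiv ^^ l) ?T) x\<bar> \<le> C * h ^ r"
    using cand_poly_derivs_near_taylor[OF u r] by blast
  obtain M where M: "0 \<le> M" "\<And>h x l. 0 < h \<Longrightarrow> h \<le> 1 \<Longrightarrow> \<bar>x - a\<bar> \<le> 2 * h \<Longrightarrow> 1 \<le> l \<Longrightarrow> l < r \<Longrightarrow>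
    \<bar>h ^ l * poly ((pderiv ^^ l) ?T) x\<bar> \<le> M * h ^ (n + 1)"
    using taylor_poly_derivs_bound[of n u a r] crit by blast
  define c where "c = \<bar>(deriv ^^ (n + 1)) u a\<bar> / 2"
  have c: "0 < c" using noncrit by (simp add: c_def)
  have "((\<lambda>x. \<bar>poly ((pderiv ^^ (n + 1)) ?T) x\<bar>) \<longlongrightarrow> \<bar>poly ((pderiv ^^ (n + 1)) ?T) a\<bar>) (nhds a)"
    by (intro tendsto_intros filterlim_ident)
  moreover have "c < \<bar>poly ((pderiv ^^ (n + 1)) ?T) a\<bar>"
    using noncrit n by (simp add: higher_pderiv_taylor_poly c_def del: funpow.simps)
  ultimately have "\<forall>\<^sub>F x in nhds a. c < \<bar>poly ((pderiv ^^ (n + 1)) ?T) x\<bar>"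
    by (rule order_tendstoD)
  then obtain \<rho> where \<rho>: "0 < \<rho>" "\<And>x. \<bar>x - a\<bar> < \<rho> \<Longrightarrow> c < \<bar>poly ((pderiv ^^ (n + 1)) ?T) x\<bar>"
    unfolding eventually_nhds_metric dist_real_def by blast
  define D where "D = real r * C * (2 * M + C) / c\<^sup>2"
  have "\<forall>\<^sub>F h in at_right 0. \<forall>x0 j. \<bar>edge x0 h j - a\<bar> \<le> h \<longrightarrow>
     (\<exists>b>0. \<forall>s<r. \<bar>smooth_ind r u x0 h j s - b\<bar> \<le> D * h ^ (r - 1 - n) * b)"
    using C(2) eventually_mult_less_at_right_0[OF \<rho>(1), of 2] eventually_mult_less_at_right_0[OF zero_less_one, of 1]
      eventually_at_right_less[of 0]
  proof eventually_elim
    case (elim h)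
    have h: "0 < h" "h \<le> 1" using elim by simp_all
    show ?case
    proof (intro allI impI)
      fix x0 j assume near: "\<bar>edge x0 h j - a\<bar> \<le> h"
      let ?e = "edge x0 h j"
      have dist: "\<bar>x - a\<bar> \<le> 2 * h" if "x \<in> {?e - h..?e}" for x using that near by auto
      define b where "b = js_indicator r ?T ?e h"
      have lower: "h ^ (2 * (n + 1)) * c\<^sup>2 \<le> b"
        unfolding b_def
      proof (rule js_indicator_ge[OF h(1)])
        fix x assume "x \<in> {?e - h..?e}"
        from dist[OF this] elim(2) show "c \<le> \<bar>poly ((pderiv ^^ (n + 1)) ?T) x\<bar>"
          using \<rho>(2)[of x] by simp
      qed (use n c in auto)
      have "\<bar>smooth_ind r u x0 h j s - b\<bar> \<le> D * h ^ (r - 1 - n) * b" if s: "s < r" for s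
      proof -
        have hr: "h ^ r \<le> h ^ (n + 1)" using n h by (intro power_decreasing) auto
        have "\<bar>smooth_ind r u x0 h j s - b\<bar> \<le> real r * (C * h ^ r * (2 * (M * h ^ (n + 1)) + C * h ^ r))"
          unfolding b_def smooth_ind_eq_js_indicator[OF h(1)]
        proof (rule js_indicator_perturbation[OF h(1)])
          show "0 \<le> C * h ^ r" "0 \<le> M * h ^ (n + 1)" using C(1) M(1) h by simp_all
        next
          fix l x assume "1 \<le> l" "l < r" "x \<in> {?e - h..?e}"
          then show "\<bar>h ^ l * poly ((pderiv ^^ l) (cand_poly r u x0 h j s)) x - h ^ l * poly ((pderiv ^^ l) ?T) x\<bar> \<le> C * h ^ r"
            using elim(1) near s by (meson less_imp_le)
        next
          fix l x assume "1 \<le> l" "l < r" "x \<in> {?e - h..?e}"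
          then show "\<bar>h ^ l * poly ((pderiv ^^ l) ?T) x\<bar> \<le> M * h ^ (n + 1)"
            using M(2)[OF h dist] by blast
        qed
        also have "\<dots> \<le> real r * (C * h ^ r * (2 * (M * h ^ (n + 1)) + C * h ^ (n + 1)))"
          using C(1) h hr by (intro mult_left_mono add_left_mono) auto
        also have "\<dots> = real r * C * (2 * M + C) * h ^ (r + (n + 1))"
          by (simp add: power_add algebra_simps)
        \<comment> \<open>Split off the power \<open>2 * (n + 1)\<close> of the lower bound for \<open>b\<close>.\<close>
        also have "r + (n + 1) = (r - 1 - n) + 2 * (n + 1)" using n by simp
        also have "real r * C * (2 * M + C) * h ^ ((r - 1 - n) + 2 * (n + 1))
            = D * h ^ (r - 1 - n) * (h ^ (2 * (n + 1)) * c\<^sup>2)"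
          using c by (simp add: D_def power_add field_simps)
        also have "\<dots> \<le> D * h ^ (r - 1 - n) * b"
          using lower C(1) M(1) h by (intro mult_left_mono) (auto simp: D_def)
        finally show ?thesis .
      qed
      moreover have "0 < b" using lower c h(1) by (smt (verit) mult_pos_pos zero_less_power)
      ultimately show "\<exists>b>0. \<forall>s<r. \<bar>smooth_ind r u x0 h j s - b\<bar> \<le> D * h ^ (r - 1 - n) * b" by blast
    qed
  qed
  moreover have "0 \<le> D" using C(1) M(1) by (simp add: D_def)
  ultimately show ?thesis by blast
qed

section \<open>Nonlinear weights\<close>

text \<open>For \<open>S\<close> the sum of the \<open>t l\<close>, the numerator of \<open>t s / S - d s\<close> is \<open>(t s - d s) + d s * (1 - S)\<close>, and
\<open>S\<close> stays above one half.\<close>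

lemma normalized_weight_perturbation:
  fixes d t :: "nat \<Rightarrow> real"
  assumes d: "(\<Sum>l<r. d l) = 1" "\<And>l. l < r \<Longrightarrow> 0 \<le> d l \<and> d l \<le> 1"
    and t: "\<And>l. l < r \<Longrightarrow> \<bar>t l - d l\<bar> \<le> \<eta>" and small: "real r * \<eta> \<le> 1 / 2" and s: "s < r"
  shows "1 / 2 \<le> (\<Sum>l<r. t l)" "\<bar>t s / (\<Sum>l<r. t l) - d s\<bar> \<le> 2 * (1 + real r) * \<eta>"
proof -
  let ?S = "\<Sum>l<r. t l"
  have "\<bar>?S - 1\<bar> = \<bar>\<Sum>l<r. t l - d l\<bar>" by (simp add: sum_subtractf d(1))
  also have "\<dots> \<le> (\<Sum>l<r. \<eta>)" by (intro order.trans[OF sum_abs] sum_mono t) simp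
  finally have S: "\<bar>?S - 1\<bar> \<le> real r * \<eta>" by simp
  then show half: "1 / 2 \<le> ?S" using small by linarith
  have eq: "t s / ?S - d s = ((t s - d s) + d s * (1 - ?S)) / ?S"
    using half by (simp add: field_simps)
  have "\<bar>d s * (1 - ?S)\<bar> \<le> 1 * (real r * \<eta>)"
    unfolding abs_mult using d(2)[OF s] S by (intro mult_mono) auto
  then have "\<bar>(t s - d s) + d s * (1 - ?S)\<bar> \<le> \<eta> + real r * \<eta>"
    using t[OF s] by linarith
  then have "\<bar>t s / ?S - d s\<bar> \<le> (\<eta> + real r * \<eta>) / (1 / 2)"
    unfolding eq abs_divide using half t[OF s] by (intro frac_le) auto
  then show "\<bar>t s / ?S - d s\<bar> \<le> 2 * (1 + real r) * \<eta>" by (simp add: algebra_simps)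
qed

lemma inverse_square_ratio_near_1:
  fixes Y y \<kappa> :: real
  assumes "0 < Y" "\<bar>y - Y\<bar> \<le> \<kappa> * Y" "\<kappa> \<le> 1 / 2"
  shows "0 < y" "\<bar>(Y / y)\<^sup>2 - 1\<bar> \<le> 6 * \<kappa>"
proof -
  have "\<kappa> * Y \<le> (1 / 2) * Y" using assms(1,3) by (intro mult_right_mono) auto
  then have y: "Y \<le> 2 * y" using assms(2) by linarith
  then show "0 < y" using assms(1) by linarith
  have k: "0 \<le> \<kappa>" using assms(1,2) by (smt (verit) mult_neg_pos)
  have q: "0 \<le> Y / y" "Y / y \<le> 2" using y \<open>0 < y\<close> assms(1) by (auto simp: field_simps)
  have "\<bar>Y / y - 1\<bar> = \<bar>y - Y\<bar> / y"
    using \<open>0 < y\<close> by (simp add: abs_if field_simps)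
  also have "\<dots> \<le> \<kappa> * (Y / y)"
    using assms(2) \<open>0 < y\<close> by (simp add: divide_right_mono)
  also have "\<dots> \<le> \<kappa> * 2" using k q by (intro mult_left_mono)
  finally have "\<bar>Y / y - 1\<bar> \<le> 2 * \<kappa>" by simp
  moreover have "\<bar>Y / y + 1\<bar> \<le> 3" using q by linarith
  moreover have "(Y / y)\<^sup>2 - 1 = (Y / y - 1) * (Y / y + 1)"
    by (simp add: power2_eq_square algebra_simps)
  ultimately show "\<bar>(Y / y)\<^sup>2 - 1\<bar> \<le> 6 * \<kappa>"
    using mult_mono[of "\<bar>Y / y - 1\<bar>" "2 * \<kappa>" "\<bar>Y / y + 1\<bar>" 3] k by (simp add: abs_mult)
qed

text \<open>The weights do not change when all \<open>\<alpha>\<close> are multiplied by \<open>(\<epsilon> + b)^2\<close>. The relative deviation of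
\<open>\<epsilon> + \<beta>\<close> from \<open>\<epsilon> + b\<close> is at most that of \<open>\<beta>\<close> from \<open>b\<close>, whatever \<open>\<epsilon>\<close> is. The factor 12 is 6 for the squared
ratio times 2 for the normalization.\<close>

lemma js_weight_near_opt_weight:
  assumes b: "0 < b" and eps: "0 < eps"
    and \<beta>: "\<And>l. l < r \<Longrightarrow> \<bar>smooth_ind r u x0 h j l - b\<bar> \<le> \<kappa> * b"
    and \<kappa>: "12 * real r * \<kappa> \<le> 1" and s: "s < r" and r: "2 \<le> r"
  shows "\<bar>js_weight r eps u x0 h j s - opt_weight r s\<bar> \<le> 12 * (1 + real r) * \<kappa>"
proof -
  let ?y = "\<lambda>l. eps + smooth_ind r u x0 h j l"
  let ?Y = "eps + b"
  let ?t = "\<lambda>l. opt_weight r l * (?Y / ?y l)\<^sup>2"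
  have Y: "0 < ?Y" using b eps by simp
  have k0: "0 \<le> \<kappa>" using \<beta>[OF s] b by (smt (verit) mult_neg_pos)
  have "1 * \<kappa> \<le> real r * \<kappa>" using k0 r by (intro mult_right_mono) auto
  then have \<kappa>2: "\<kappa> \<le> 1 / 2" using \<kappa> by linarith
  have close: "\<bar>?y l - ?Y\<bar> \<le> \<kappa> * ?Y" if "l < r" for l
    using \<beta>[OF that] mult_nonneg_nonneg[OF k0 less_imp_le[OF eps]] by (simp add: algebra_simps)
  note ratio = inverse_square_ratio_near_1[OF Y close \<kappa>2]
  have d: "0 \<le> opt_weight r l \<and> opt_weight r l \<le> 1" if "l < r" for l
    using opt_weight_pos[OF that] opt_weight_less_1[OF r that] by simp
  have t: "\<bar>?t l - opt_weight r l\<bar> \<le> 6 * \<kappa>" if "l < r" for l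
  proof -
    have "?t l - opt_weight r l = opt_weight r l * ((?Y / ?y l)\<^sup>2 - 1)"
      by (simp add: right_diff_distrib)
    then have "\<bar>?t l - opt_weight r l\<bar> = opt_weight r l * \<bar>(?Y / ?y l)\<^sup>2 - 1\<bar>"
      using d[OF that] by (simp only: abs_mult abs_of_nonneg)
    also have "\<dots> \<le> 1 * (6 * \<kappa>)" using d[OF that] ratio(2)[OF that] by (intro mult_mono) auto
    finally show ?thesis by simp
  qed
  have \<alpha>: "?t l = ?Y\<^sup>2 * js_alpha r eps u x0 h j l" for l
    by (simp add: js_alpha_def power_divide)
  have "js_weight r eps u x0 h j s = ?t s / (\<Sum>l<r. ?t l)"
    unfolding \<alpha> js_weight_def sum_distrib_left[symmetric] using Y by simp
  moreover have "\<bar>?t s / (\<Sum>l<r. ?t l) - opt_weight r s\<bar> \<le> 2 * (1 + real r) * (6 * \<kappa>)"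
    by (rule normalized_weight_perturbation(2)[OF _ d t _ s]) (use sum_opt_weight r \<kappa> in auto)
  ultimately show ?thesis by (simp add: algebra_simps)
qed

text \<open>The order to which the mapping minus \<open>d\<close> vanishes at \<open>\<omega> = d\<close>.\<close>

definition flat_order :: "nat \<Rightarrow> nat" where
  "flat_order k = (if even k then k + 1 else k + 2)"

text \<open>For odd \<open>k\<close> and small \<open>x\<close> the smoothed sign is \<open>x\<close> divided by a quantity bounded below. So it supplies
one additional factor \<open>x\<close>, and also makes the product with \<open>x^k\<close> nonnegative.\<close>

lemma maim_f_bound:
  assumes "0 < A" "0 < \<delta>"
  shows "\<exists>F\<ge>0. \<exists>\<eta>>0. \<forall>\<omega>. \<bar>\<omega> - opt_weight r s\<bar> \<le> \<eta> \<longrightarrow>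
    0 \<le> maim_f r k A \<delta> s \<omega> * (\<omega> - opt_weight r s) ^ k \<and>
    \<bar>maim_f r k A \<delta> s \<omega> * (\<omega> - opt_weight r s) ^ (k + 1)\<bar> \<le> F * \<bar>\<omega> - opt_weight r s\<bar> ^ flat_order k"
proof (cases "even k")
  case True
  then have "maim_f r k A \<delta> s \<omega> = A" for \<omega> by (simp add: maim_f_def)
  then show ?thesis
    using assms True
    by (intro exI[of _ A] conjI exI[of _ 1]) (auto simp: flat_order_def abs_mult power_abs zero_le_mult_iff zero_le_even_power)
next
  case False
  define z where "z = (3 * \<delta>\<^sup>2 / 4) ^ (k + 3)"
  have z: "0 < z" using assms by (simp add: z_def)
  have "0 \<le> maim_f r k A \<delta> s \<omega> * x ^ k \<and> \<bar>maim_f r k A \<delta> s \<omega> * x ^ (k + 1)\<bar> \<le> A / z * \<bar>x\<bar> ^ (k + 2)"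
    if x_def: "x = \<omega> - opt_weight r s" and x: "\<bar>x\<bar> \<le> \<delta> / 2" for \<omega> x
  proof -
    let ?v = "(\<delta>\<^sup>2 - x\<^sup>2) ^ (k + 3) + \<bar>x\<bar>"
    have "x\<^sup>2 \<le> (\<delta> / 2)\<^sup>2" using x assms by (intro iffD1[OF abs_le_square_iff]) auto
    then have "3 * \<delta>\<^sup>2 / 4 \<le> \<delta>\<^sup>2 - x\<^sup>2" by (simp add: power_divide)
    then have "z \<le> (\<delta>\<^sup>2 - x\<^sup>2) ^ (k + 3)" unfolding z_def by (intro power_mono) auto
    then have v: "z \<le> ?v" by simp
    have f: "maim_f r k A \<delta> s \<omega> = A * x / ?v"
      using False x assms by (simp add: maim_f_def sg_def x_def)
    have "0 \<le> x * x ^ k" using False zero_le_even_power[of "Suc k" x] by simp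
    then have "0 \<le> A * (x * x ^ k) / ?v" using assms(1) v z by (intro divide_nonneg_nonneg) auto
    moreover have "\<bar>maim_f r k A \<delta> s \<omega> * x ^ (k + 1)\<bar> = A * \<bar>x\<bar> ^ (k + 2) / ?v"
      unfolding f using assms v z by (simp add: abs_mult power_abs mult_ac)
    moreover have "A * \<bar>x\<bar> ^ (k + 2) / ?v \<le> A * \<bar>x\<bar> ^ (k + 2) / z"
      using v z assms by (intro divide_left_mono mult_nonneg_nonneg mult_pos_pos) auto
    ultimately show ?thesis by (simp add: f)
  qed
  then show ?thesis
    using assms z False
    by (intro exI[of _ "A / z"] conjI exI[of _ "\<delta> / 2"]) (auto simp: flat_order_def)
qed

text \<open>The first summand of the denominator is nonnegative, and the second is bounded below as soon as the
exponents are bounded above; so the order of the numerator is the order of the mapping.\<close>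

lemma maim_map_flat:
  assumes "0 < A" "0 < \<delta>" "0 \<le> M" "2 \<le> r" "s < r"
  shows "\<exists>K\<ge>0. \<exists>\<eta>>0. \<forall>T b w \<omega>. \<bar>\<omega> - opt_weight r s\<bar> \<le> \<eta> \<longrightarrow>
    ada0 r k T b w s \<omega> \<le> M \<longrightarrow> ada1 r k T b w s \<omega> \<le> M \<longrightarrow>
    \<bar>maim_map r k A \<delta> T b w s \<omega> - opt_weight r s\<bar> \<le> K * \<bar>\<omega> - opt_weight r s\<bar> ^ flat_order k"
proof -
  let ?d = "opt_weight r s"
  have d: "0 < ?d" "?d < 1" using assms opt_weight_pos opt_weight_less_1 by auto
  obtain F \<eta> where F: "0 \<le> F" "0 < \<eta>" "\<And>\<omega>. \<bar>\<omega> - ?d\<bar> \<le> \<eta> \<Longrightarrow>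
    0 \<le> maim_f r k A \<delta> s \<omega> * (\<omega> - ?d) ^ k \<and>
    \<bar>maim_f r k A \<delta> s \<omega> * (\<omega> - ?d) ^ (k + 1)\<bar> \<le> F * \<bar>\<omega> - ?d\<bar> ^ flat_order k"
    using maim_f_bound[OF assms(1,2)] by metis
  define c where "c = (?d / 2) powr M * ((1 - ?d) / 2) powr M"
  define \<eta>' where "\<eta>' = min \<eta> (min (?d / 2) ((1 - ?d) / 2))"
  have c: "0 < c" using d by (simp add: c_def)
  have "\<bar>maim_map r k A \<delta> T b w s \<omega> - ?d\<bar> \<le> F / c * \<bar>\<omega> - ?d\<bar> ^ flat_order k"
    if \<omega>: "\<bar>\<omega> - ?d\<bar> \<le> \<eta>'" and ada: "ada0 r k T b w s \<omega> \<le> M" "ada1 r k T b w s \<omega> \<le> M" for T b w \<omega>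
  proof -
    let ?f = "maim_f r k A \<delta> s \<omega>"
    let ?p = "\<omega> powr ada0 r k T b w s \<omega> * (1 - \<omega>) powr ada1 r k T b w s \<omega>"
    have f: "0 \<le> ?f * (\<omega> - ?d) ^ k" "\<bar>?f * (\<omega> - ?d) ^ (k + 1)\<bar> \<le> F * \<bar>\<omega> - ?d\<bar> ^ flat_order k"
      using F(3)[of \<omega>] \<omega> by (auto simp: \<eta>'_def)
    have "\<bar>\<omega> - ?d\<bar> \<le> ?d / 2" "\<bar>\<omega> - ?d\<bar> \<le> (1 - ?d) / 2" using \<omega> by (simp_all only: \<eta>'_def min.bounded_iff)
    from abs_le_D2[OF this(1)] abs_le_D1[OF this(2)] have 0: "?d / 2 \<le> \<omega>" "(1 - ?d) / 2 \<le> 1 - \<omega>" by (simp_all add: field_simps)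
    \<comment> \<open>For a base in \<open>(0, 1]\<close> a larger exponent gives a smaller power.\<close>
    have powr_ge: "y powr M \<le> x powr e" if "0 < y" "y \<le> x" "x \<le> 1" "e \<le> M" for x y e :: real
    proof -
      have "y powr M \<le> x powr M" using that assms(3) by (intro powr_mono2) auto
      also have "\<dots> \<le> x powr e" using that by (intro powr_mono') auto
      finally show ?thesis .
    qed
    have "c \<le> ?p"
      unfolding c_def using 0 d ada by (intro mult_mono powr_ge) auto
    then have den: "c \<le> ?f * (\<omega> - ?d) ^ k + ?p" using f(1) by linarith
    have "\<bar>maim_map r k A \<delta> T b w s \<omega> - ?d\<bar> = \<bar>?f * (\<omega> - ?d) ^ (k + 1)\<bar> / (?f * (\<omega> - ?d) ^ k + ?p)"
      using den c by (simp add: maim_map_def abs_divide)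
    also have "\<dots> \<le> F * \<bar>\<omega> - ?d\<bar> ^ flat_order k / c"
      using f den c by (intro frac_le) auto
    finally show ?thesis by simp
  qed
  moreover have "0 < \<eta>'" using F(2) d by (simp add: \<eta>'_def)
  moreover have "0 \<le> F / c" using F(1) c by simp
  ultimately show ?thesis by blast
qed

lemma Max_div_Min_le:
  fixes f :: "nat \<Rightarrow> real"
  assumes "0 < c" "0 < r" "\<And>l. l < r \<Longrightarrow> c / 2 \<le> f l \<and> f l \<le> 2 * c"
  shows "Max (f ` {..<r}) / Min (f ` {..<r}) \<le> 4"
proof -
  have "Max (f ` {..<r}) \<le> 2 * c" using assms by (subst Max_le_iff) auto
  moreover have "c / 2 \<le> Min (f ` {..<r})" using assms by (subst Min_ge_iff) auto
  ultimately have "Max (f ` {..<r}) / Min (f ` {..<r}) \<le> (2 * c) / (c / 2)"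
    using assms(1) by (intro frac_le) auto
  then show ?thesis using assms(1) by simp
qed

text \<open>Type 1 needs \<open>\<omega>\<close> and \<open>1 - \<omega>\<close> bounded away from 0. The ratios of types 3 and 4 are bounded because the
indicators, respectively the quotients \<open>\<omega>/d\<close>, lie within a factor 2 of a common value.\<close>

lemma ada_bounded:
  assumes adm: "admissible r k T" and "1 \<le> k" "2 \<le> r" "s < r"
  shows "\<exists>M\<ge>0. \<forall>b w \<omega> c. \<bar>\<omega> - opt_weight r s\<bar> \<le> min (opt_weight r s / 2) ((1 - opt_weight r s) / 2) \<longrightarrow>
     0 < c \<longrightarrow> (\<forall>l<r. c / 2 \<le> b l \<and> b l \<le> 2 * c) \<longrightarrow>
     (\<forall>l<r. opt_weight r l / 2 \<le> w l \<and> w l \<le> 2 * opt_weight r l) \<longrightarrow>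
     ada0 r k T b w s \<omega> \<le> M \<and> ada1 r k T b w s \<omega> \<le> M"
proof -
  let ?d = "opt_weight r s"
  have d: "0 < ?d" "?d < 1" using assms opt_weight_pos opt_weight_less_1 by auto
  show ?thesis
  proof (cases T)
    case (MAIM1 m)
    then obtain \<alpha> where "\<alpha> s > 0" "\<alpha> s / (real k + 1) \<le> m s"
      using adm assms(4) by auto
    then have m: "0 < m s" by (smt (verit) divide_pos_pos of_nat_0_le_iff)
    have quot: "x / (m s * y) \<le> 2 / m s" if "0 < x" "x / 2 \<le> y" for x y :: real
    proof -
      have "m s * x \<le> m s * (2 * y)" using that m by (intro mult_left_mono) auto
      then show ?thesis using m that by (simp add: divide_simps mult_ac)
    qed
    have "?d / (m s * \<omega>) \<le> 2 / m s \<and> (1 - ?d) / (m s * (1 - \<omega>)) \<le> 2 / m s"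
      if "\<bar>\<omega> - ?d\<bar> \<le> min (?d / 2) ((1 - ?d) / 2)" for \<omega>
    proof -
      have "\<bar>\<omega> - ?d\<bar> \<le> ?d / 2" "\<bar>\<omega> - ?d\<bar> \<le> (1 - ?d) / 2" using that by (simp_all only: min.bounded_iff)
      from abs_le_D2[OF this(1)] abs_le_D1[OF this(2)]
      have "?d / 2 \<le> \<omega>" "(1 - ?d) / 2 \<le> 1 - \<omega>" by (simp_all add: field_simps)
      then show ?thesis using quot d by simp
    qed
    then show ?thesis using m MAIM1 by (intro exI[of _ "2 / m s"]) auto
  next
    case (MAIM2 Q CFS)
    then show ?thesis by (intro exI[of _ "max 1 (Q * real k)"]) auto
  next
    case MAIM3
    have "Max (b ` {..<r}) / Min (b ` {..<r}) \<le> 4"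
      if "0 < c" "\<forall>l<r. c / 2 \<le> b l \<and> b l \<le> 2 * c" for b :: "nat \<Rightarrow> real" and c
      using that assms(3) by (intro Max_div_Min_le[of c]) auto
    then show ?thesis using MAIM3 by (intro exI[of _ 4]) auto
  next
    case MAIM4
    have "Max ((\<lambda>l. w l / opt_weight r l) ` {..<r}) / Min ((\<lambda>l. w l / opt_weight r l) ` {..<r}) \<le> 4"
      if "\<forall>l<r. opt_weight r l / 2 \<le> w l \<and> w l \<le> 2 * opt_weight r l" for w
      using that assms(3) opt_weight_pos[of _ r]
      by (intro Max_div_Min_le[of 1]) (auto simp: field_simps)
    then show ?thesis using MAIM4 by (intro exI[of _ 4]) auto
  next
    case (MAIM5 C)
    then show ?thesis using adm by (intro exI[of _ C]) auto
  qed
qed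

text \<open>With \<open>K = \<lceil>r / (r-1-n)\<rceil> - 2\<close>, the least admissible \<open>k\<close> is the least odd number not below \<open>K\<close>, and
the flatness order is the least odd number above \<open>k\<close>; so it is at least \<open>K + 2\<close>.\<close>

lemma k_maim_flat_order:
  assumes "n < r - 1" "k_maim r n \<le> real k"
  shows "r \<le> (r - 1 - n) * flat_order k"
proof -
  define q where "q = r - 1 - n"
  have q: "1 \<le> q" "q < r" "real r - 1 - real n = real q" using assms(1) by (auto simp: q_def of_nat_diff)
  define K where "K = \<lceil>real r / real q - 2\<rceil>"
  have "1 < real r / real q" using q by simp
  then have "0 \<le> K" by (simp add: K_def)
  then obtain m where m: "K = int m" using nonneg_int_cases by blast
  have "real r / real q - 2 \<le> of_int K" unfolding K_def by (rule le_of_int_ceiling)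
  then have "real r / real q - 2 \<le> real m" using m by simp
  then have r: "real r \<le> real q * (real m + 2)" using q by (simp add: field_simps)
  have "k_maim r n = real m + (1 + (-1) ^ m) / 2"
    unfolding k_maim_def q(3) K_def[symmetric] Let_def m by simp
  then have "real m + (1 + (-1) ^ m) / 2 \<le> real k" using assms(2) by simp
  then have "m + 2 \<le> flat_order k"
    by (cases "even m"; cases "even k"; cases "k = m") (auto simp: flat_order_def)
  then have "real q * (real m + 2) \<le> real q * real (flat_order k)" by (intro mult_left_mono) auto
  then have "real r \<le> real (q * flat_order k)" using r by simp
  then show ?thesis unfolding q_def[symmetric] by linarith
qed

text \<open>The \<open>O(h^(r-1-n))\<close> deviation of the WENO-JS weights is raised to the power \<open>flat_order k\<close> by the mapping, and
the normalization preserves the order.\<close>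

lemma maim_weight_near_opt_weight:
  assumes u: "smooth_near u a" and n: "n + 1 < r"
    and crit: "\<And>m. 1 \<le> m \<Longrightarrow> m \<le> n \<Longrightarrow> (deriv ^^ m) u a = 0"
    and noncrit: "(deriv ^^ (n + 1)) u a \<noteq> 0"
    and A: "0 < A" and \<delta>: "0 < \<delta>" and k: "1 \<le> k" and adm: "admissible r k T"
    and flat: "r \<le> (r - 1 - n) * flat_order k"
  shows "\<exists>C. \<forall>\<^sub>F h in at_right 0. \<forall>x0 j eps. \<bar>edge x0 h j - a\<bar> \<le> h \<longrightarrow> 0 < eps \<longrightarrow>
     (\<Sum>s<r. maim_weight r k A \<delta> T eps u x0 h j s) = 1 \<and>
     (\<forall>s<r. \<bar>maim_weight r k A \<delta> T eps u x0 h j s - opt_weight r s\<bar> \<le> C * h ^ r)"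
proof -
  have r: "2 \<le> r" using n by simp
  define p where "p = r - 1 - n"
  have p: "0 < p" using n by (simp add: p_def)
  let ?d = "opt_weight r"
  have d: "0 < ?d s" "?d s < 1" if "s < r" for s
    using that r opt_weight_pos opt_weight_less_1 by auto
  obtain D where D: "0 \<le> D" "\<forall>\<^sub>F h in at_right 0. \<forall>x0 j. \<bar>edge x0 h j - a\<bar> \<le> h \<longrightarrow>
     (\<exists>b>0. \<forall>s<r. \<bar>smooth_ind r u x0 h j s - b\<bar> \<le> D * h ^ p * b)"
    using smooth_ind_relative_spread[OF u n crit noncrit] unfolding p_def by blast
  define E where "E = 12 * (1 + real r) * D"
  have E: "0 \<le> E" using D(1) by (simp add: E_def)
  have "\<forall>s\<in>{..<r}. \<exists>M\<ge>0. \<forall>b w \<omega> c. \<bar>\<omega> - ?d s\<bar> \<le> min (?d s / 2) ((1 - ?d s) / 2) \<longrightarrow>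
     0 < c \<longrightarrow> (\<forall>l<r. c / 2 \<le> b l \<and> b l \<le> 2 * c) \<longrightarrow> (\<forall>l<r. ?d l / 2 \<le> w l \<and> w l \<le> 2 * ?d l) \<longrightarrow>
     ada0 r k T b w s \<omega> \<le> M \<and> ada1 r k T b w s \<omega> \<le> M"
    using ada_bounded[OF adm k r] by blast
  then obtain M where M: "\<And>s. s < r \<Longrightarrow> 0 \<le> M s" "\<And>s b w \<omega> c. s < r \<Longrightarrow> \<bar>\<omega> - ?d s\<bar> \<le> min (?d s / 2) ((1 - ?d s) / 2) \<Longrightarrow>
     0 < c \<Longrightarrow> (\<forall>l<r. c / 2 \<le> b l \<and> b l \<le> 2 * c) \<Longrightarrow> (\<forall>l<r. ?d l / 2 \<le> w l \<and> w l \<le> 2 * ?d l) \<Longrightarrow>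
     ada0 r k T b w s \<omega> \<le> M s \<and> ada1 r k T b w s \<omega> \<le> M s"
    by (subst (asm) bchoice_iff) (metis lessThan_iff)
  have "\<forall>s\<in>{..<r}. \<exists>K \<eta>. 0 \<le> K \<and> 0 < \<eta> \<and> (\<forall>T b w \<omega>. \<bar>\<omega> - ?d s\<bar> \<le> \<eta> \<longrightarrow>
    ada0 r k T b w s \<omega> \<le> M s \<longrightarrow> ada1 r k T b w s \<omega> \<le> M s \<longrightarrow>
    \<bar>maim_map r k A \<delta> T b w s \<omega> - ?d s\<bar> \<le> K * \<bar>\<omega> - ?d s\<bar> ^ flat_order k)"
    using maim_map_flat[OF A \<delta> M(1) r] by (metis lessThan_iff)
  then obtain K \<eta> where K: "\<And>s. s < r \<Longrightarrow> 0 \<le> K s" "\<And>s. s < r \<Longrightarrow> 0 < \<eta> s" "\<And>s T b w \<omega>. s < r \<Longrightarrow> \<bar>\<omega> - ?d s\<bar> \<le> \<eta> s \<Longrightarrow>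
    ada0 r k T b w s \<omega> \<le> M s \<Longrightarrow> ada1 r k T b w s \<omega> \<le> M s \<Longrightarrow>
    \<bar>maim_map r k A \<delta> T b w s \<omega> - ?d s\<bar> \<le> K s * \<bar>\<omega> - ?d s\<bar> ^ flat_order k"
    unfolding bchoice_iff by (metis lessThan_iff)
  define \<eta>' where "\<eta>' s = min (\<eta> s) (min (?d s / 2) ((1 - ?d s) / 2))" for s
  have \<eta>': "0 < \<eta>' s" if "s < r" for s using K(2) d that by (simp add: \<eta>'_def)
  \<comment> \<open>A sum of the constants of the finitely many \<open>s\<close> serves as their common bound.\<close>
  define G where "G = (\<Sum>s<r. K s) * E ^ flat_order k"
  have G: "0 \<le> G" using K(1) E by (auto simp: G_def intro!: mult_nonneg_nonneg sum_nonneg)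
  have ev_\<eta>: "\<forall>\<^sub>F h in at_right 0. \<forall>s\<in>{..<r}. E * h ^ p < \<eta>' s"
    using \<eta>' p by (intro eventually_ball_finite ballI eventually_mult_power_less_at_right_0) auto
  have ev_D: "\<forall>\<^sub>F h in at_right 0. 12 * real r * D * h ^ p < 1"
    using p by (intro eventually_mult_power_less_at_right_0) auto
  have ev_G: "\<forall>\<^sub>F h in at_right 0. real r * G * h ^ r < 1 / 2"
    using r by (intro eventually_mult_power_less_at_right_0) auto
  have "\<forall>\<^sub>F h in at_right 0. \<forall>x0 j eps. \<bar>edge x0 h j - a\<bar> \<le> h \<longrightarrow> 0 < eps \<longrightarrow>
     (\<Sum>s<r. maim_weight r k A \<delta> T eps u x0 h j s) = 1 \<and>
     (\<forall>s<r. \<bar>maim_weight r k A \<delta> T eps u x0 h j s - ?d s\<bar> \<le> 2 * (1 + real r) * G * h ^ r)"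
    using D(2) ev_\<eta> ev_D ev_G eventually_mult_less_at_right_0[OF zero_less_one, of 1]
      eventually_at_right_less[of 0]
  proof eventually_elim
    case (elim h)
    have h: "0 < h" "h \<le> 1" using elim by simp_all
    show ?case
    proof (intro allI impI)
      fix x0 j eps
      assume near: "\<bar>edge x0 h j - a\<bar> \<le> h" and eps: "0 < (eps :: real)"
      let ?w = "js_weight r eps u x0 h j"
      let ?\<alpha> = "maim_alpha r k A \<delta> T eps u x0 h j"
      obtain b where b: "0 < b" "\<And>s. s < r \<Longrightarrow> \<bar>smooth_ind r u x0 h j s - b\<bar> \<le> D * h ^ p * b"
        using elim(1) near by blast
      have w: "\<bar>?w s - ?d s\<bar> \<le> E * h ^ p" if "s < r" for s
        using js_weight_near_opt_weight[OF b(1) eps b(2) _ that r] elim(3) by (simp add: E_def mult_ac)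
      have half_double: "y / 2 \<le> x \<and> x \<le> 2 * y" if "0 < y" "\<bar>x - y\<bar> \<le> y / 2" for x y :: real
        using abs_le_D1[OF that(2)] abs_le_D2[OF that(2)] that(1) by (simp add: field_simps)
      have "1 * (D * h ^ p) \<le> real r * (D * h ^ p)" using D(1) h r by (intro mult_right_mono) auto
      then have "D * h ^ p \<le> 1 / 2" using elim(3) by (simp add: mult_ac)
      then have "D * h ^ p * b \<le> 1 / 2 * b" using b(1) by (intro mult_right_mono) auto
      then have half: "D * h ^ p * b \<le> b / 2" by simp
      have \<beta>: "\<forall>l<r. b / 2 \<le> smooth_ind r u x0 h j l \<and> smooth_ind r u x0 h j l \<le> 2 * b"
        using half_double[OF b(1) order.trans[OF b(2) half]] by blast
      have w_half: "\<bar>?w s - ?d s\<bar> \<le> min (?d s / 2) ((1 - ?d s) / 2)" "\<bar>?w s - ?d s\<bar> \<le> \<eta> s" if "s < r" for s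
      proof -
        have "\<bar>?w s - ?d s\<bar> \<le> \<eta>' s" using w[OF that] elim(2) that by force
        then show "\<bar>?w s - ?d s\<bar> \<le> min (?d s / 2) ((1 - ?d s) / 2)" "\<bar>?w s - ?d s\<bar> \<le> \<eta> s"
          unfolding \<eta>'_def by simp_all
      qed
      have w_ratio: "\<forall>l<r. ?d l / 2 \<le> ?w l \<and> ?w l \<le> 2 * ?d l"
        using half_double[OF d(1)] w_half(1) unfolding min.bounded_iff by blast
      have \<alpha>: "\<bar>?\<alpha> s - ?d s\<bar> \<le> G * h ^ r" if s: "s < r" for s
      proof -
        have "\<bar>?\<alpha> s - ?d s\<bar> \<le> K s * \<bar>?w s - ?d s\<bar> ^ flat_order k"
          unfolding maim_alpha_def
          using M(2)[OF s w_half(1)[OF s] b(1) \<beta> w_ratio] by (intro K(3) s w_half) auto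
        also have "\<dots> \<le> K s * (E * h ^ p) ^ flat_order k"
          using K(1) s w by (intro mult_left_mono power_mono) auto
        also have "\<dots> = K s * E ^ flat_order k * h ^ (p * flat_order k)"
          by (simp add: power_mult_distrib power_mult)
        also have "\<dots> \<le> K s * E ^ flat_order k * h ^ r"
          using K(1) s E h flat by (intro mult_left_mono power_decreasing) (auto simp: p_def)
        also have "\<dots> \<le> G * h ^ r"
          unfolding G_def using K(1) s E h
          by (intro mult_right_mono member_le_sum) auto
        finally show ?thesis .
      qed
      have small: "real r * (G * h ^ r) \<le> 1 / 2" using elim(4) by (simp add: mult_ac)
      have d01: "0 \<le> ?d s \<and> ?d s \<le> 1" if "s < r" for s using d[OF that] by simp
      have sum_d: "(\<Sum>s<r. ?d s) = 1" using r by (intro sum_opt_weight) auto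
      note norm = normalized_weight_perturbation[OF sum_d d01 \<alpha> small]
      have "(\<Sum>s<r. ?\<alpha> s) \<noteq> 0" using norm(1)[of 0] r by simp
      then have "(\<Sum>s<r. maim_weight r k A \<delta> T eps u x0 h j s) = 1"
        by (simp add: maim_weight_def sum_divide_distrib[symmetric])
      moreover have "\<bar>maim_weight r k A \<delta> T eps u x0 h j s - ?d s\<bar> \<le> 2 * (1 + real r) * G * h ^ r"
        if "s < r" for s
        using norm(2)[OF _ _ that] by (simp add: maim_weight_def mult_ac)
      ultimately show "(\<Sum>s<r. maim_weight r k A \<delta> T eps u x0 h j s) = 1 \<and>
         (\<forall>s<r. \<bar>maim_weight r k A \<delta> T eps u x0 h j s - ?d s\<bar> \<le> 2 * (1 + real r) * G * h ^ r)" by blast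
    qed
  qed
  then show ?thesis by blast
qed

section \<open>Order of accuracy\<close>

text \<open>Both sets of weights have the same sum, so a common value \<open>v\<close> can be subtracted from all candidates;
the errors of weights and candidates multiply.\<close>

lemma nonlinear_minus_optimal_bound:
  fixes \<omega> d c :: "nat \<Rightarrow> real"
  assumes "(\<Sum>s<r. \<omega> s) = (\<Sum>s<r. d s)"
    and "\<And>s. s < r \<Longrightarrow> \<bar>\<omega> s - d s\<bar> \<le> B" and "\<And>s. s < r \<Longrightarrow> \<bar>c s - v\<bar> \<le> B'"
  shows "\<bar>(\<Sum>s<r. \<omega> s * c s) - (\<Sum>s<r. d s * c s)\<bar> \<le> real r * (B * B')"
proof -
  have "(\<Sum>s<r. \<omega> s * c s) - (\<Sum>s<r. d s * c s) = (\<Sum>s<r. (\<omega> s - d s) * (c s - v))"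
    using assms(1)
    by (simp add: left_diff_distrib right_diff_distrib sum_subtractf sum_distrib_right[symmetric])
  also have "\<bar>\<dots>\<bar> \<le> (\<Sum>s<r. B * B')"
  proof (intro order.trans[OF sum_abs] sum_mono)
    fix s assume "s \<in> {..<r}"
    then show "\<bar>(\<omega> s - d s) * (c s - v)\<bar> \<le> B * B'"
      unfolding abs_mult using assms(2,3)[of s] by (intro mult_mono) auto
  qed
  finally show ?thesis by simp
qed

lemma maim_recon_near_opt_recon:
  assumes u: "smooth_near u a" and r: "0 < r"
    and weights: "\<forall>\<^sub>F h in at_right 0. \<forall>x0 j eps. \<bar>edge x0 h j - a\<bar> \<le> h \<longrightarrow> 0 < eps \<longrightarrow>
     (\<Sum>s<r. maim_weight r k A \<delta> T eps u x0 h j s) = 1 \<and>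
     (\<forall>s<r. \<bar>maim_weight r k A \<delta> T eps u x0 h j s - opt_weight r s\<bar> \<le> C * h ^ r)"
  shows "\<exists>B. \<forall>\<^sub>F h in at_right 0. \<forall>x0 j eps. \<bar>edge x0 h j - a\<bar> \<le> h \<longrightarrow> 0 < eps \<longrightarrow>
     \<bar>maim_recon r k A \<delta> T eps u x0 h j - opt_recon r u (edge x0 h j) h\<bar> \<le> B * h ^ (2 * r)"
proof -
  let ?T = "taylor_poly u a r"
  obtain C' where C': "\<forall>\<^sub>F h in at_right 0. \<forall>x0 j s l. \<forall>x\<in>{edge x0 h j - h .. edge x0 h j}.
     \<bar>edge x0 h j - a\<bar> \<le> h \<longrightarrow> s < r \<longrightarrow> l \<le> r \<longrightarrow>
     \<bar>h ^ l * poly ((pderiv ^^ l) (cand_poly r u x0 h j s)) x - h ^ l * poly ((pderiv ^^ l) ?T) x\<bar> \<le> C' * h ^ r"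
    using cand_poly_derivs_near_taylor[OF u r] by blast
  have "\<forall>\<^sub>F h in at_right 0. \<forall>x0 j eps. \<bar>edge x0 h j - a\<bar> \<le> h \<longrightarrow> 0 < eps \<longrightarrow>
     \<bar>maim_recon r k A \<delta> T eps u x0 h j - opt_recon r u (edge x0 h j) h\<bar> \<le> real r * C * C' * h ^ (2 * r)"
    using weights C' eventually_at_right_less[of 0]
  proof eventually_elim
    case (elim h)
    show ?case
    proof (intro allI impI)
      fix x0 j eps
      assume near: "\<bar>edge x0 h j - a\<bar> \<le> h" and eps: "0 < (eps :: real)"
      let ?e = "edge x0 h j"
      have e: "?e \<in> {?e - h..?e}" using elim(3) by simp
      have cand: "\<bar>cand_value r u x0 h j s - poly ?T ?e\<bar> \<le> C' * h ^ r" if "s < r" for s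
        using elim(2)[rule_format, OF e near that, of 0] by (simp add: cand_value_def)
      have opt: "opt_recon r u ?e h = (\<Sum>s<r. opt_weight r s * cand_value r u x0 h j s)"
        by (simp add: opt_recon_def cand_value_def cand_poly_eq_avg_recon[OF elim(3) r])
      have "\<bar>maim_recon r k A \<delta> T eps u x0 h j - opt_recon r u ?e h\<bar> \<le> real r * ((C * h ^ r) * (C' * h ^ r))"
        unfolding maim_recon_def opt
        using elim(1) near eps cand
        by (intro nonlinear_minus_optimal_bound) (auto simp: sum_opt_weight[OF r])
      also have "\<dots> = real r * C * C' * h ^ (2 * r)"
        by (simp add: mult_2 power_add)
      finally show "\<bar>maim_recon r k A \<delta> T eps u x0 h j - opt_recon r u ?e h\<bar> \<le> real r * C * C' * h ^ (2 * r)" .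
    qed
  qed
  then show ?thesis by blast
qed

text \<open>The Taylor polynomial of degree below \<open>2r\<close> has the same linear defect at both edges, so only errors of
order \<open>h^(2r)\<close> remain before the division by \<open>h\<close>.\<close>

lemma maim_flux_difference_accuracy:
  fixes u :: "real \<Rightarrow> real"
  assumes u: "smooth_near u a" and n: "n + 1 < r"
    and crit: "\<And>m. 1 \<le> m \<Longrightarrow> m \<le> n \<Longrightarrow> (deriv ^^ m) u a = 0"
    and noncrit: "(deriv ^^ (n + 1)) u a \<noteq> 0"
    and A: "0 < A" and \<delta>: "0 < \<delta>" and k: "1 \<le> k" and adm: "admissible r k T"
    and flat: "r \<le> (r - 1 - n) * flat_order k"
  shows "\<exists>B. \<forall>\<^sub>F h in at_right 0. \<forall>eps x0 j. 0 < eps \<longrightarrow> a \<in> cell x0 h j \<longrightarrow>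
     \<bar>(maim_recon r k A \<delta> T eps u x0 h j - maim_recon r k A \<delta> T eps u x0 h (j - 1)) / h
       - (u (edge x0 h j) - u (edge x0 h (j - 1))) / h\<bar> \<le> B * h ^ (2 * r - 1)"
proof -
  have r: "0 < r" "0 < 2 * r" using n by simp_all
  let ?V = "taylor_poly u a (2 * r)"
  have degV: "degree ?V \<le> 2 * r - 1" using degree_taylor_poly[OF r(2), of u a] by simp
  obtain C where C: "\<forall>\<^sub>F h in at_right 0. \<forall>x0 j eps. \<bar>edge x0 h j - a\<bar> \<le> h \<longrightarrow> 0 < eps \<longrightarrow>
     \<bar>maim_recon r k A \<delta> T eps u x0 h j - opt_recon r u (edge x0 h j) h\<bar> \<le> C * h ^ (2 * r)"
    using maim_weight_near_opt_weight[OF u n crit noncrit A \<delta> k adm flat]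
      maim_recon_near_opt_recon[OF u r(1)] by meson
  obtain C' where C': "\<forall>\<^sub>F h in at_right 0. \<forall>e. \<bar>e - a\<bar> \<le> h \<longrightarrow>
     \<bar>opt_recon r u e h - opt_recon r (poly ?V) e h\<bar> \<le> C' * h ^ (2 * r) \<and> \<bar>u e - poly ?V e\<bar> \<le> C' * h ^ (2 * r)"
    using opt_recon_near_taylor[OF u r] by blast
  have "\<forall>\<^sub>F h in at_right 0. \<forall>eps x0 j. 0 < eps \<longrightarrow> a \<in> cell x0 h j \<longrightarrow>
     \<bar>(maim_recon r k A \<delta> T eps u x0 h j - maim_recon r k A \<delta> T eps u x0 h (j - 1)) / h
       - (u (edge x0 h j) - u (edge x0 h (j - 1))) / h\<bar> \<le> (2 * C + 4 * C') * h ^ (2 * r - 1)"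
    using C C' eventually_at_right_less[of 0]
  proof eventually_elim
    case (elim h)
    show ?case
    proof (intro allI impI)
      fix eps x0 j
      assume eps: "0 < (eps :: real)" and cell: "a \<in> cell x0 h j"
      let ?e = "edge x0 h j"
      let ?R = "maim_recon r k A \<delta> T eps u x0 h"
      let ?O = "\<lambda>f e. opt_recon r f e h"
      have e': "edge x0 h (j - 1) = ?e - h" using edge_shift[of x0 h j "-1"] by simp
      have near: "\<bar>?e - a\<bar> \<le> h" "\<bar>edge x0 h (j - 1) - a\<bar> \<le> h"
        using cell by (auto simp: cell_def e')
      have R: "\<bar>?R j - ?O u ?e\<bar> \<le> C * h ^ (2 * r)" "\<bar>?R (j - 1) - ?O u (?e - h)\<bar> \<le> C * h ^ (2 * r)"
        using elim(1) near eps e' by metis+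
      have V: "\<bar>?O u ?e - ?O (poly ?V) ?e\<bar> \<le> C' * h ^ (2 * r)" "\<bar>u ?e - poly ?V ?e\<bar> \<le> C' * h ^ (2 * r)"
        "\<bar>?O u (?e - h) - ?O (poly ?V) (?e - h)\<bar> \<le> C' * h ^ (2 * r)" "\<bar>u (?e - h) - poly ?V (?e - h)\<bar> \<le> C' * h ^ (2 * r)"
        using elim(2) near e' by simp_all
      have cancel: "?O (poly ?V) (?e - h) - poly ?V (?e - h) = ?O (poly ?V) ?e - poly ?V ?e"
        by (rule opt_recon_defect_shift[OF elim(3) r(1) degV])
      have main: "\<bar>(?R j - ?R (j - 1)) - (u ?e - u (?e - h))\<bar> \<le> (2 * C + 4 * C') * h ^ (2 * r)"
        using R V cancel unfolding distrib_right by linarith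
      have "\<bar>(?R j - ?R (j - 1)) / h - (u ?e - u (?e - h)) / h\<bar> = \<bar>(?R j - ?R (j - 1)) - (u ?e - u (?e - h))\<bar> / h"
        using elim(3) by (simp add: diff_divide_distrib[symmetric])
      also have "\<dots> \<le> (2 * C + 4 * C') * h ^ (2 * r) / h"
        using main elim(3) by (intro divide_right_mono) auto
      also have "\<dots> = (2 * C + 4 * C') * h ^ (2 * r - 1)"
        by (subst power_minus_mult[OF r(2), symmetric]) (use elim(3) in simp)
      finally show "\<bar>(?R j - ?R (j - 1)) / h - (u ?e - u (edge x0 h (j - 1))) / h\<bar>
          \<le> (2 * C + 4 * C') * h ^ (2 * r - 1)"
        unfolding e' .
    qed
  qed
  then show ?thesis by blast
qed

theorem theorem2:
  fixes r ncp k :: nat and A \<delta> xs :: real and T :: maim_type and u :: "real \<Rightarrow> real"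
  assumes "2 \<le> r" and "r \<le> 9"
    and "ncp < r - 1"
    and "1 \<le> k" and "real k \<ge> k_maim r ncp"
    and "A > 0" and "\<delta> > 0"
    and "admissible r k T"
    and "smooth_near u xs"
    and "\<And>l. 1 \<le> l \<Longrightarrow> l \<le> ncp \<Longrightarrow> (deriv ^^ l) u xs = 0"
    and "(deriv ^^ (ncp + 1)) u xs \<noteq> 0"
  shows "\<exists>B H. H > 0 \<and>
    (\<forall>eps h x0 j. 0 < eps \<longrightarrow> 0 < h \<longrightarrow> h < H \<longrightarrow> xs \<in> cell x0 h j \<longrightarrow>
       \<bar>(maim_recon r k A \<delta> T eps u x0 h j - maim_recon r k A \<delta> T eps u x0 h (j - 1)) / h
         - (u (edge x0 h j) - u (edge x0 h (j - 1))) / h\<bar> \<le> B * h ^ (2 * r - 1))"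
proof -
  have "ncp + 1 < r" using assms(3) by simp
  from maim_flux_difference_accuracy[OF assms(9) this assms(10,11,6,7,4,8)
      k_maim_flat_order[OF assms(3,5)]]
  show ?thesis unfolding eventually_at_right_field by blast
qed

end
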